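(* Let $n$ be a positive integer, let $r>0$, and let $G$ be an $n$-vertex graph with at most $r$ cherries. Then every locally $\left(\frac{n}{560\, r^{3/4}}\right)$-bounded coloring $c$ of $E(K_n)$ is $G$-proper.
   Context: A cherry in a graph is a path on three vertices (counted as a subgraph). An edge-coloring $c$ of $E(K_n)$ is locally $k$-bounded if for every vertex $v$ of $K_n$, no color appears on more than $k$ of the edges incident to $v$. A coloring $c$ of $E(K_n)$ is $G$-proper if there is a copy of $G$ in $K_n$ on which $c$ induces a proper edge-coloring, i.e., no two edges of the copy sharing a vertex have the same color. *)

theory Defs
  imports Complex_Main "HOL-Library.Ramsey"
begin

definition simple_graph :: "'a set \<Rightarrow> 'a set set \<Rightarrow> bool" where
  "simple_graph V E \<longleftrightarrow> finite V \<and> E \<subseteq> nsets V 2"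

definition complete_edges :: "nat \<Rightarrow> nat set set" where
  "complete_edges n = nsets {..<n} 2"

text \<open>Cherries are counted as (not necessarily induced) subgraphs, so a triangle contains three.\<close>

definition cherries :: "'a set \<Rightarrow> 'a set set \<Rightarrow> ('a set \<times> 'a set set) set" where
  "cherries V E = {(W, F). W \<subseteq> V \<and> F \<subseteq> E \<and>
     (\<exists>u v w. distinct [u, v, w] \<and> W = {u, v, w} \<and> F = {{u, v}, {v, w}})}"

definition graph_isomorphic :: "'a set \<Rightarrow> 'a set set \<Rightarrow> 'b set \<Rightarrow> 'b set set \<Rightarrow> bool" where
  "graph_isomorphic V E W F \<longleftrightarrow> (\<exists>f. bij_betw f V W \<and> F = (\<lambda>e. f ` e) ` E)"

definition locally_bounded :: "nat \<Rightarrow> real \<Rightarrow> (nat set \<Rightarrow> 'c) \<Rightarrow> bool" where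
  "locally_bounded n k c \<longleftrightarrow>
     (\<forall>v<n. \<forall>a. real (card {e \<in> complete_edges n. v \<in> e \<and> c e = a}) \<le> k)"

definition proper_edge_coloring :: "('b set \<Rightarrow> 'c) \<Rightarrow> 'b set set \<Rightarrow> bool" where
  "proper_edge_coloring c F \<longleftrightarrow>
     (\<forall>e\<in>F. \<forall>e'\<in>F. e \<noteq> e' \<and> e \<inter> e' \<noteq> {} \<longrightarrow> c e \<noteq> c e')"

definition graph_proper :: "nat \<Rightarrow> 'a set \<Rightarrow> 'a set set \<Rightarrow> (nat set \<Rightarrow> 'c) \<Rightarrow> bool" where
  "graph_proper n V E c \<longleftrightarrow>
     (\<exists>W F. W \<subseteq> {..<n} \<and> F \<subseteq> complete_edges n \<and> graph_isomorphic V E W F \<and>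
        proper_edge_coloring c F)"

end

theory Submission
  imports Defs "HOL-Library.FuncSet"
begin

text \<open>
  Let \<open>s\<close> be the fourth root of \<open>r\<close> and \<open>k\<close> the local bound on the colouring, so that
  \<open>560 s\<^sup>3 k \<le> n\<close>. A uniformly random embedding and the lopsided local lemma succeed if every vertex
  lies on \<open>O(s\<^sup>3)\<close> cherries. At most \<open>s\<close> vertices violate this. These heavy vertices are first
  embedded greedily into a set that contains no monochromatic cherry and any two of whose elements
  are the leaves of at most \<open>2sk\<close> monochromatic cherries of the complete graph; the light vertices
  are then embedded at random. An event fixes the images of the light vertices of a cherry of \<open>G\<close>.

  Two points keep the dependencies through a common image small. Events with one light vertex are
  identified when they forbid the same image, which leaves at most one per image and neighbour of
  the heavy set. For an image \<open>b\<close> of a leaf, the numbers of monochromatic cherries with leaves \<open>x\<close>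
  and \<open>b\<close>, with \<open>x\<close> ranging over the heavy images, add up to at most \<open>(1 + o(1)) n\<close>: a vertex that is
  a centre for both \<open>x\<close> and \<open>x'\<close> is also the centre of a monochromatic cherry with leaves \<open>x\<close> and
  \<open>x'\<close>, so the sets of centres hardly overlap.
\<close>

section \<open>The lopsided local lemma for random bijections\<close>

text \<open>Cardinalities take the place of probabilities, which avoids conditioning on a possibly
  empty set. The induction keeps the conditional share of \<open>A i\<close> below
  \<open>2 * p i\<close>, and the neighbourhood weight \<open>1 / 4\<close> makes that at most one
  half.\<close>

lemma lopsided_local_lemma:
  fixes A :: "'i \<Rightarrow> 'w set" and nb :: "'i \<Rightarrow> 'i \<Rightarrow> bool" and p :: "'i \<Rightarrow> real"
  assumes fin: "finite \<Omega>" "finite I" and ne: "\<Omega> \<noteq> {}"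
    and lop: "\<And>i J. i \<in> I \<Longrightarrow> J \<subseteq> I \<Longrightarrow> \<forall>j\<in>J. \<not> nb i j \<Longrightarrow>
      real (card (A i \<inter> (\<Omega> - \<Union>(A ` J)))) \<le> p i * real (card (\<Omega> - \<Union>(A ` J)))"
    and p: "\<And>i. i \<in> I \<Longrightarrow> 0 \<le> p i"
    and refl: "\<And>i. i \<in> I \<Longrightarrow> nb i i"
    and sum: "\<And>i. i \<in> I \<Longrightarrow> (\<Sum>j | j \<in> I \<and> nb i j. p j) \<le> 1 / 4"
  shows "\<Omega> - \<Union>(A ` I) \<noteq> {}"
proof -
  define av where "av J = \<Omega> - \<Union>(A ` J)" for J
  have finav: "finite (av J)" for J
    using fin by (simp add: av_def)
  have key: "real (card (A i \<inter> av J)) \<le> 2 * p i * real (card (av J))" if "i \<in> I" "J \<subseteq> I" for i J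
    using that
  proof (induction "card J" arbitrary: i J rule: less_induct)
    case less
    define J1 where "J1 = {j \<in> J. nb i j}"
    define J2 where "J2 = {j \<in> J. \<not> nb i j}"
    have finJ: "finite J" "finite J1"
      using less.prems fin by (auto simp: J1_def intro: finite_subset)
    have J: "J = J1 \<union> J2" "J2 \<subseteq> I"
      using less.prems by (auto simp: J1_def J2_def)
    have up: "real (card (A i \<inter> av J2)) \<le> p i * real (card (av J2))"
      unfolding av_def using lop[OF less.prems(1) J(2)] by (auto simp: J2_def)
    have each: "real (card (A j \<inter> av J2)) \<le> 2 * p j * real (card (av J2))" if "j \<in> J1" for j
    proof (rule less.hyps)
      \<comment> \<open>\<open>J2\<close> lacks the element \<open>j\<close> of \<open>J1\<close>,
        so the induction hypothesis is available for \<open>J2\<close>.\<close>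
      have "J2 \<subset> J"
        using that by (auto simp: J1_def J2_def)
      then show "card J2 < card J"
        by (rule psubset_card_mono[OF finJ(1)])
    qed (use that less.prems J(2) in \<open>auto simp: J1_def\<close>)
    \<comment> \<open>Inside \<open>av J2\<close> the events of \<open>J1\<close> cover at most the
      share \<open>2 * (1 / 4)\<close>, so at least half of \<open>av J2\<close> survives in
      \<open>av J\<close>. This is the origin of the factor 2 in the claim.\<close>
    have "av J2 \<subseteq> av J \<union> (\<Union>j\<in>J1. A j \<inter> av J2)"
      using J(1) by (auto simp: av_def)
    then have "card (av J2) \<le> card (av J \<union> (\<Union>j\<in>J1. A j \<inter> av J2))"
      by (intro card_mono) (use finav finJ in auto)
    also have "\<dots> \<le> card (av J) + card (\<Union>j\<in>J1. A j \<inter> av J2)"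
      by (rule card_Un_le)
    also have "\<dots> \<le> card (av J) + (\<Sum>j\<in>J1. card (A j \<inter> av J2))"
      by (rule add_left_mono) (rule card_UN_le[OF finJ(2)])
    finally have "real (card (av J2)) \<le> real (card (av J)) + (\<Sum>j\<in>J1. real (card (A j \<inter> av J2)))"
      by (simp only: of_nat_sum[symmetric] of_nat_add[symmetric] of_nat_le_iff)
    also have "\<dots> \<le> real (card (av J)) + (\<Sum>j\<in>J1. 2 * p j * real (card (av J2)))"
      using each by (intro add_left_mono sum_mono) auto
    also have "(\<Sum>j\<in>J1. 2 * p j * real (card (av J2))) = 2 * real (card (av J2)) * (\<Sum>j\<in>J1. p j)"
      by (simp add: sum_distrib_left sum_distrib_right mult_ac)
    also have "(\<Sum>j\<in>J1. p j) \<le> (\<Sum>j | j \<in> I \<and> nb i j. p j)"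
      by (rule sum_mono2) (use fin less.prems p in \<open>auto simp: J1_def\<close>)
    also have "\<dots> \<le> 1 / 4"
      using sum less.prems by blast
    finally have half: "real (card (av J2)) \<le> 2 * real (card (av J))"
      by (simp add: mult_left_mono)
    have "card (A i \<inter> av J) \<le> card (A i \<inter> av J2)"
      by (intro card_mono) (use finav J in \<open>auto simp: av_def\<close>)
    then have "real (card (A i \<inter> av J)) \<le> p i * real (card (av J2))"
      using up by linarith
    also have "\<dots> \<le> p i * (2 * real (card (av J)))"
      using half p less.prems by (intro mult_left_mono) auto
    finally show ?case
      by simp
  qed
  have pos: "av J \<noteq> {}" if "finite J" "J \<subseteq> I" for J
    using that
  proof (induction J rule: finite_induct)
    case empty
    then show ?case using ne by (simp add: av_def)
  next
    case (insert i J)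
    then have i: "i \<in> I" and IH: "0 < card (av J)"
      using finav by (auto simp: card_gt_0_iff)
    \<comment> \<open>By \<open>refl\<close>, \<open>i\<close> belongs to its own neighbourhood,
      hence \<open>p i \<le> 1 / 4\<close> and \<open>A i\<close> cannot exhaust
      \<open>av J\<close>.\<close>
    have "p i \<le> (\<Sum>j | j \<in> I \<and> nb i j. p j)"
      by (rule member_le_sum) (use i refl p fin in auto)
    then have "2 * p i \<le> 1 / 2"
      using sum[OF i] by linarith
    then have "2 * p i * real (card (av J)) \<le> 1 / 2 * real (card (av J))"
      by (rule mult_right_mono) simp
    moreover have "real (card (A i \<inter> av J)) \<le> 2 * p i * real (card (av J))"
      using key i insert.prems by blast
    ultimately have "real (card (A i \<inter> av J)) < real (card (av J))"
      using IH by linarith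
    then have "card (A i \<inter> av J) < card (av J)"
      by simp
    then have "av J - A i \<noteq> {}"
      by (metis Diff_eq_empty_iff inf.absorb2 less_irrefl)
    then show ?case
      by (auto simp: av_def)
  qed
  show ?thesis
    using pos[OF fin(2)] by (simp add: av_def)
qed


section \<open>Switching and negative dependency for uniformly random bijections\<close>

lemma card_injections_ge:
  fixes N :: real
  assumes "finite A" "finite B" "0 \<le> N" "N + real (card A) \<le> real (card B) + 1"
  shows "N ^ card A \<le> real (card {h \<in> A \<rightarrow>\<^sub>E B. inj_on h A})"
proof -
  have "card {h \<in> A \<rightarrow>\<^sub>E B. inj_on h A} = prod ((-) (card B)) {0..<card A}"
    using card_inj_on_subset_funcset[of A B A] assms by simp
  moreover have "N ^ card A = (\<Prod>i\<in>{0..<card A}. N)"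
    by simp
  \<comment> \<open>The smallest factor is \<open>card B - card A + 1\<close>, which explains the
    \<open>+ 1\<close> in the hypothesis on \<open>N\<close>.\<close>
  moreover have "\<dots> \<le> (\<Prod>i\<in>{0..<card A}. real (card B - i))"
    using assms by (intro prod_mono) auto
  ultimately show ?thesis
    by simp
qed

text \<open>The sets \<open>Y - X\<close> and \<open>X - Y\<close> have equal size, and any
  bijection from the first to the second closes \<open>p\<close> up to a permutation.\<close>

lemma extend_bij_betw:
  assumes "finite X" "finite Y" "bij_betw p X Y"
  obtains q where "bij_betw q (X \<union> Y) (X \<union> Y)" "\<And>x. x \<in> X \<Longrightarrow> q x = p x"
proof -
  have "card X = card Y"
    using assms bij_betw_same_card by blast
  then have "card (Y - X) = card (X - Y)"
    using assms by (metis Int_commute card_Diff_subset_Int finite_Int)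
  then obtain t where t: "bij_betw t (Y - X) (X - Y)"
    using assms finite_same_card_bij by blast
  define q where "q x = (if x \<in> X then p x else t x)" for x
  have "bij_betw q X Y"
    using assms(3) by (rule bij_betw_cong[THEN iffD1, rotated]) (simp add: q_def)
  moreover have "bij_betw q (Y - X) (X - Y)"
    using t by (rule bij_betw_cong[THEN iffD1, rotated]) (simp add: q_def)
  ultimately have "bij_betw q (X \<union> (Y - X)) (Y \<union> (X - Y))"
    by (rule bij_betw_combine) auto
  moreover have "X \<union> (Y - X) = X \<union> Y" "Y \<union> (X - Y) = X \<union> Y"
    by auto
  ultimately show ?thesis
    using that[of q] by (simp add: q_def)
qed

definition extends :: "('a \<times> 'b) set \<Rightarrow> ('a \<Rightarrow> 'b) \<Rightarrow> bool" where
  "extends e f \<longleftrightarrow> (\<forall>(u, x)\<in>e. f u = x)"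

definition partial_injection :: "('a \<times> 'b) set \<Rightarrow> bool" where
  "partial_injection e \<longleftrightarrow> finite e \<and> inj_on fst e \<and> inj_on snd e"

definition bijections :: "'a set \<Rightarrow> 'b set \<Rightarrow> ('a \<Rightarrow> 'b) set" where
  "bijections L Q = {f \<in> extensional L. bij_betw f L Q}"

definition touching :: "('a \<times> 'b) set \<Rightarrow> ('a \<times> 'b) set \<Rightarrow> bool" where
  "touching e e' \<longleftrightarrow> fst ` e \<inter> fst ` e' \<noteq> {} \<or> snd ` e \<inter> snd ` e' \<noteq> {}"

lemma finite_bijections:
  assumes "finite L" "finite Q"
  shows "finite (bijections L Q)"
  by (rule finite_subset[OF _ finite_PiE[OF assms(1), of "\<lambda>_. Q"]])
    (use assms(2) in \<open>auto simp: bijections_def bij_betw_def PiE_def\<close>)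

text \<open>Erdos and Spencer's switching: moving the values prescribed by \<open>e\<close> to those of \<open>h\<close> by a
  permutation of the target cannot create an event that does not touch \<open>e\<close>.\<close>

lemma switching:
  assumes fin: "finite L" "finite Q" and e: "partial_injection e" "e \<subseteq> L \<times> Q"
    and J: "\<And>e'. e' \<in> J \<Longrightarrow> \<not> touching e e'" "\<And>e'. e' \<in> J \<Longrightarrow> e' \<subseteq> L \<times> Q"
    and h: "h \<in> fst ` e \<rightarrow> Q" "inj_on h (fst ` e)"
  shows "card {f \<in> bijections L Q. extends e f \<and> (\<forall>e'\<in>J. \<not> extends e' f)}
    \<le> card {f \<in> bijections L Q. (\<forall>u\<in>fst ` e. f u = h u) \<and> (\<forall>e'\<in>J. \<not> extends e' f)}"
    (is "card ?F \<le> card ?G")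
proof -
  define X where "X = snd ` e"
  define Y where "Y = h ` fst ` e"
  have XY: "finite X" "finite Y" "X \<subseteq> Q" "Y \<subseteq> Q"
    using e h by (auto simp: X_def Y_def partial_injection_def)
  define p where "p = h \<circ> fst \<circ> inv_into e snd"
  have p: "p x = h u" if "(u, x) \<in> e" for u x
    using e(1) that inv_into_f_f[of snd e "(u, x)"] by (simp add: p_def partial_injection_def)
  have "bij_betw (inv_into e snd) X e"
    using e(1) by (simp add: X_def partial_injection_def bij_betw_inv_into inj_on_imp_bij_betw)
  moreover have "bij_betw fst e (fst ` e)" "bij_betw h (fst ` e) Y"
    using e(1) h by (simp_all add: Y_def partial_injection_def inj_on_imp_bij_betw)
  ultimately have "bij_betw p X Y"
    unfolding p_def comp_assoc by (intro bij_betw_trans)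
  then obtain q0 where q0: "bij_betw q0 (X \<union> Y) (X \<union> Y)" "\<And>x. x \<in> X \<Longrightarrow> q0 x = p x"
    using extend_bij_betw XY by metis
  \<comment> \<open>The switching permutation of \<open>Q\<close>: it carries the values of
    \<open>e\<close> to those of \<open>h\<close> and fixes every point outside
    \<open>X \<union> Y\<close>.\<close>
  define q where "q x = (if x \<in> X \<union> Y then q0 x else x)" for x
  have qXY: "bij_betw q (X \<union> Y) (X \<union> Y)"
    using q0(1) by (rule bij_betw_cong[THEN iffD1, rotated]) (simp add: q_def)
  have "bij_betw q (Q - (X \<union> Y)) (Q - (X \<union> Y))"
    by (rule bij_betw_cong[THEN iffD1, OF _ bij_betw_id]) (simp add: q_def)
  with qXY have "bij_betw q ((X \<union> Y) \<union> (Q - (X \<union> Y))) ((X \<union> Y) \<union> (Q - (X \<union> Y)))"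
    by (rule bij_betw_combine) auto
  moreover have "(X \<union> Y) \<union> (Q - (X \<union> Y)) = Q"
    using XY by auto
  ultimately have q: "bij_betw q Q Q"
    by simp
  have qe: "q x = h u" if "(u, x) \<in> e" for u x
  proof -
    have "x \<in> X"
      using that by (force simp: X_def)
    then show ?thesis
      using q0(2) p[OF that] by (simp add: q_def)
  qed
  have sub: "compose L q f \<in> ?G" if "f \<in> ?F" for f
  proof -
    have f: "bij_betw f L Q" "extends e f" "\<forall>e'\<in>J. \<not> extends e' f"
      using that by (auto simp: bijections_def)
    have bij: "bij_betw (compose L q f) L Q"
      using f(1) q by (rule bij_betw_compose)
    have val: "compose L q f u = h u" if u: "u \<in> fst ` e" for u
      using u f(2) e(2) qe by (auto simp: compose_def extends_def)
    have "\<not> extends e' (compose L q f)" if e': "e' \<in> J" for e'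
    proof
      assume ext: "extends e' (compose L q f)"
      have "f w = z" if wz: "(w, z) \<in> e'" for w z
      proof -
        have w: "w \<notin> fst ` e" and z: "z \<notin> X"
          using J(1)[OF e'] wz by (force simp: touching_def X_def)+
        have wL: "w \<in> L"
          using J(2)[OF e'] wz by auto
        have fz: "compose L q f w = z"
          using ext wz by (auto simp: extends_def)
        \<comment> \<open>A point of \<open>Y\<close> is already the value of
          \<open>compose L q f\<close> at a first component of \<open>e\<close>; injectivity would
          make \<open>w\<close> that component, although \<open>e\<close> and \<open>e'\<close> do
          not touch.\<close>
        have "z \<notin> Y"
        proof
          assume "z \<in> Y"
          then obtain u where u: "u \<in> fst ` e" "z = compose L q f u"
            using val by (auto simp: Y_def)
          moreover have "u \<in> L"
            using u(1) e(2) by auto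
          ultimately have "u = w"
            using inj_onD[OF bij_betw_imp_inj_on[OF bij], of u w] fz wL by simp
          then show False
            using u w by simp
        qed
        \<comment> \<open>Since \<open>q\<close> permutes \<open>X \<union> Y\<close>, the value
          \<open>z\<close> outside this set comes from a point outside it, where \<open>q\<close> is
          the identity.\<close>
        moreover have "f w \<notin> X \<union> Y"
        proof
          assume a: "f w \<in> X \<union> Y"
          then have "q (f w) \<in> X \<union> Y"
            using qXY by (auto simp: bij_betw_def)
          then show False
            using fz wL z \<open>z \<notin> Y\<close> by (simp add: compose_def)
        qed
        ultimately show ?thesis
          using fz wL by (simp add: compose_def q_def)
      qed
      then show False
        using f(3) e' by (auto simp: extends_def)
    qed
    then show ?thesis
      using bij val by (auto simp: bijections_def)
  qed
  have inj: "inj_on (compose L q) ?F"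
  proof (rule inj_onI)
    fix f f' assume a: "f \<in> ?F" "f' \<in> ?F" "compose L q f = compose L q f'"
    show "f = f'"
    proof (rule extensionalityI[of _ L])
      fix u assume u: "u \<in> L"
      then have "q (f u) = q (f' u)"
        using fun_cong[OF a(3), of u] by (simp add: compose_def)
      moreover have "f u \<in> Q" "f' u \<in> Q"
        using a u by (auto simp: bijections_def bij_betw_def)
      ultimately show "f u = f' u"
        using q by (auto simp: bij_betw_def inj_on_def)
    qed (use a in \<open>auto simp: bijections_def\<close>)
  qed
  show ?thesis
    by (rule card_inj_on_le[OF inj]) (use sub finite_bijections[OF fin] in auto)
qed

text \<open>By \<open>switching\<close>, prescribing the values of any injection \<open>h\<close>
  leaves at least as many bijections avoiding \<open>J\<close> as prescribing those of
  \<open>e\<close>. Different \<open>h\<close> give disjoint classes, and there are at least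
  \<open>N ^ card e\<close> of them.\<close>

lemma negative_dependency:
  fixes N :: real
  assumes fin: "finite L" "finite Q" and e: "partial_injection e" "e \<subseteq> L \<times> Q"
    and J: "\<And>e'. e' \<in> J \<Longrightarrow> \<not> touching e e'" "\<And>e'. e' \<in> J \<Longrightarrow> e' \<subseteq> L \<times> Q"
    and N: "0 < N" "N + real (card e) \<le> real (card Q) + 1"
  shows "real (card {f \<in> bijections L Q. extends e f \<and> (\<forall>e'\<in>J. \<not> extends e' f)})
    \<le> (1 / N) ^ card e * real (card {f \<in> bijections L Q. \<forall>e'\<in>J. \<not> extends e' f})"
proof -
  define D where "D = fst ` e"
  define H where "H = {h \<in> D \<rightarrow>\<^sub>E Q. inj_on h D}"
  define av where "av = {f \<in> bijections L Q. \<forall>e'\<in>J. \<not> extends e' f}"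
  let ?c = "card {f \<in> bijections L Q. extends e f \<and> (\<forall>e'\<in>J. \<not> extends e' f)}"
  let ?G = "\<lambda>h. {f \<in> bijections L Q. (\<forall>u\<in>D. f u = h u) \<and> (\<forall>e'\<in>J. \<not> extends e' f)}"
  have D: "finite D" "card D = card e"
    using e(1) by (simp_all add: D_def partial_injection_def card_image)
  have finH: "finite H"
    unfolding H_def by (rule finite_subset[OF _ finite_PiE[OF D(1), of "\<lambda>_. Q"]]) (use fin in auto)
  have finb: "finite (bijections L Q)"
    by (rule finite_bijections[OF fin])
  have "card H * ?c = (\<Sum>h\<in>H. ?c)"
    by simp
  also have "\<dots> \<le> (\<Sum>h\<in>H. card (?G h))"
    unfolding D_def
    by (rule sum_mono, rule switching[OF fin e J]) (auto simp: H_def D_def)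
  also have "\<dots> = card (\<Union>h\<in>H. ?G h)"
  proof (rule card_UN_disjoint[symmetric, OF finH])
    show "\<forall>h\<in>H. finite (?G h)"
      using finb by simp
    show "\<forall>h\<in>H. \<forall>h'\<in>H. h \<noteq> h' \<longrightarrow> ?G h \<inter> ?G h' = {}"
    proof (intro ballI impI)
      fix h h' assume h: "h \<in> H" "h' \<in> H" "h \<noteq> h'"
      then obtain u where "u \<in> D" "h u \<noteq> h' u"
        by (metis (no_types, lifting) H_def PiE_ext mem_Collect_eq)
      then show "?G h \<inter> ?G h' = {}"
        by force
    qed
  qed
  also have "\<dots> \<le> card av"
    by (rule card_mono) (use finb in \<open>auto simp: av_def\<close>)
  finally have "real (card H) * real ?c \<le> real (card av)"
    by (simp only: of_nat_mult[symmetric] of_nat_le_iff)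
  moreover have "N ^ card e \<le> real (card H)"
    using card_injections_ge[OF D(1) fin(2), of N] D(2) N by (simp add: H_def)
  ultimately have "N ^ card e * real ?c \<le> real (card av)"
    using mult_right_mono[of "N ^ card e" "real (card H)" "real ?c"] by linarith
  then show ?thesis
    using N(1) by (simp add: av_def field_simps)
qed

lemma sum_UN_le:
  fixes p :: "'a \<Rightarrow> real"
  assumes "finite I" "\<And>i. i \<in> I \<Longrightarrow> finite (X i)" "\<And>x. 0 \<le> p x"
  shows "sum p (\<Union>i\<in>I. X i) \<le> (\<Sum>i\<in>I. sum p (X i))"
  using assms(1,2)
proof (induction I rule: finite_induct)
  case (insert i I)
  have "sum p (X i \<union> (\<Union>i\<in>I. X i)) + sum p (X i \<inter> (\<Union>i\<in>I. X i)) =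
      sum p (X i) + sum p (\<Union>i\<in>I. X i)"
    using insert by (intro sum.union_inter) auto
  moreover have "0 \<le> sum p (X i \<inter> (\<Union>i\<in>I. X i))"
    by (simp add: assms(3) sum_nonneg)
  ultimately show ?case
    using insert by simp
qed simp

text \<open>An event prescribes at most three values at as many points, so the events touching it
  have total weight at most \<open>3 * (\<alpha> + \<beta>)\<close>.\<close>

lemma ex_bijection_avoiding:
  fixes N \<alpha> \<beta> :: real
  assumes fin: "finite L" "finite Q" and LQ: "card L = card Q"
    and E: "\<And>e. e \<in> \<E> \<Longrightarrow> e \<subseteq> L \<times> Q" "\<And>e. e \<in> \<E> \<Longrightarrow> partial_injection e"
      "\<And>e. e \<in> \<E> \<Longrightarrow> e \<noteq> {}" "\<And>e. e \<in> \<E> \<Longrightarrow> card e \<le> 3"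
    and N: "0 < N" "N + 2 \<le> real (card Q)"
    and \<alpha>: "\<And>u. u \<in> L \<Longrightarrow> (\<Sum>e | e \<in> \<E> \<and> u \<in> fst ` e. (1 / N) ^ card e) \<le> \<alpha>"
    and \<beta>: "\<And>x. x \<in> Q \<Longrightarrow> (\<Sum>e | e \<in> \<E> \<and> x \<in> snd ` e. (1 / N) ^ card e) \<le> \<beta>"
    and nn: "0 \<le> \<alpha>" "0 \<le> \<beta>" and small: "3 * (\<alpha> + \<beta>) \<le> 1 / 4"
  obtains f where "bij_betw f L Q" "\<And>e. e \<in> \<E> \<Longrightarrow> \<not> extends e f"
proof -
  define \<Omega> where "\<Omega> = bijections L Q"
  define A where "A e = {f \<in> \<Omega>. extends e f}" for e
  have finE: "finite \<E>"
    by (rule finite_subset[of _ "Pow (L \<times> Q)"]) (use E(1) fin in auto)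
  have av: "\<Omega> - \<Union>(A ` J) = {f \<in> \<Omega>. \<forall>e'\<in>J. \<not> extends e' f}" for J
    by (auto simp: A_def)
  have "\<Omega> - \<Union>(A ` \<E>) \<noteq> {}"
  proof (rule lopsided_local_lemma[where nb = touching and p = "\<lambda>e. (1 / N) ^ card e"])
    show "finite \<Omega>"
      unfolding \<Omega>_def by (rule finite_bijections[OF fin])
    show "\<Omega> \<noteq> {}"
    proof -
      obtain f where "bij_betw f L Q"
        using finite_same_card_bij[OF fin LQ] by blast
      then have "bij_betw (restrict f L) L Q"
        by (rule bij_betw_cong[THEN iffD1, rotated]) simp
      then have "restrict f L \<in> \<Omega>"
        by (simp add: \<Omega>_def bijections_def)
      then show ?thesis by blast
    qed
    show "real (card (A e \<inter> (\<Omega> - \<Union>(A ` J)))) \<le> (1 / N) ^ card e * real (card (\<Omega> - \<Union>(A ` J)))"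
      if e: "e \<in> \<E>" and J: "J \<subseteq> \<E>" "\<forall>e'\<in>J. \<not> touching e e'" for e J
    proof -
      have "A e \<inter> {f \<in> \<Omega>. \<forall>e'\<in>J. \<not> extends e' f} = {f \<in> \<Omega>. extends e f \<and> (\<forall>e'\<in>J. \<not> extends e' f)}"
        by (auto simp: A_def)
      \<comment> \<open>Here \<open>card e \<le> 3\<close> turns \<open>N + 2 \<le> card Q\<close>
        into the condition needed for counting injections.\<close>
      moreover have "N + real (card e) \<le> real (card Q) + 1"
        using E(4)[OF e] N(2) by linarith
      moreover have "e' \<subseteq> L \<times> Q" if "e' \<in> J" for e'
        using that J(1) E(1) by blast
      ultimately show ?thesis
        unfolding av
        using negative_dependency[OF fin E(2)[OF e] E(1)[OF e], of J N, folded \<Omega>_def] J(2) N(1)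
        by simp
    qed
    show "touching e e" if "e \<in> \<E>" for e
      using E(3)[OF that] by (simp add: touching_def)
    show "(\<Sum>e' | e' \<in> \<E> \<and> touching e e'. (1 / N) ^ card e') \<le> 1 / 4" if e: "e \<in> \<E>" for e
    proof -
      let ?p = "\<lambda>e. (1 / N) ^ card e"
      let ?X = "\<lambda>u. {e' \<in> \<E>. u \<in> fst ` e'}" and ?Y = "\<lambda>x. {e' \<in> \<E>. x \<in> snd ` e'}"
      have fe: "finite e"
        using E(2)[OF e] by (simp add: partial_injection_def)
      have p0: "0 \<le> ?p e" for e :: "('a \<times> 'b) set"
        using N(1) by simp
      have cards: "real (card (fst ` e)) \<le> 3" "real (card (snd ` e)) \<le> 3"
        using E(4)[OF e] card_image_le[OF fe, of fst] card_image_le[OF fe, of snd] by auto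
      have meet: "B \<inter> C \<noteq> {} \<longleftrightarrow> (\<exists>z\<in>B. z \<in> C)" for B C :: "'c set"
        by blast
      have "{e' \<in> \<E>. touching e e'} = (\<Union>u\<in>fst ` e. ?X u) \<union> (\<Union>x\<in>snd ` e. ?Y x)"
        unfolding touching_def meet by (simp only: set_eq_iff mem_Collect_eq Un_iff UN_iff) meson
      then have "sum ?p {e' \<in> \<E>. touching e e'} \<le> sum ?p (\<Union>u\<in>fst ` e. ?X u) + sum ?p (\<Union>x\<in>snd ` e. ?Y x)"
        using sum.union_inter[of "\<Union>u\<in>fst ` e. ?X u" "\<Union>x\<in>snd ` e. ?Y x" ?p] finE fe
          sum_nonneg[of "(\<Union>u\<in>fst ` e. ?X u) \<inter> (\<Union>x\<in>snd ` e. ?Y x)" ?p] p0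
        by simp
      also have "sum ?p (\<Union>u\<in>fst ` e. ?X u) \<le> (\<Sum>u\<in>fst ` e. sum ?p (?X u))"
        by (rule sum_UN_le) (use finE fe p0 in auto)
      also have "\<dots> \<le> (\<Sum>u\<in>fst ` e. \<alpha>)"
        by (rule sum_mono, rule \<alpha>) (use E(1)[OF e] in auto)
      also have "\<dots> \<le> 3 * \<alpha>"
        using mult_right_mono[OF cards(1) nn(1)] by simp
      also have "sum ?p (\<Union>x\<in>snd ` e. ?Y x) \<le> (\<Sum>x\<in>snd ` e. sum ?p (?Y x))"
        by (rule sum_UN_le) (use finE fe p0 in auto)
      also have "\<dots> \<le> (\<Sum>x\<in>snd ` e. \<beta>)"
        by (rule sum_mono, rule \<beta>) (use E(1)[OF e] in auto)
      also have "\<dots> \<le> 3 * \<beta>"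
        using mult_right_mono[OF cards(2) nn(2)] by simp
      finally show ?thesis
        using small by simp
    qed
  qed (use finE N in auto)
  then obtain f where "f \<in> \<Omega> - \<Union>(A ` \<E>)"
    by blast
  then show ?thesis
    using that[of f] by (auto simp: \<Omega>_def A_def bijections_def)
qed

section \<open>Cherries and degrees\<close>

text \<open>The triples list leaf, centre, leaf, so every cherry occurs twice, once for each order
  of its leaves. This is why \<open>r\<close> cherries become the bound
  \<open>2 * s ^ 4\<close>.\<close>

definition ordered_cherries :: "'a set set \<Rightarrow> ('a \<times> 'a \<times> 'a) set" where
  "ordered_cherries E = {(u, v, w). {u, v} \<in> E \<and> {v, w} \<in> E \<and> u \<noteq> w}"

definition neighbours :: "'a set set \<Rightarrow> 'a \<Rightarrow> 'a set" where
  "neighbours E v = {u. {u, v} \<in> E}"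

definition ordered_cherries_at :: "'a set set \<Rightarrow> 'a \<Rightarrow> ('a \<times> 'a \<times> 'a) set" where
  "ordered_cherries_at E a = {(u, v, w) \<in> ordered_cherries E. a \<in> {u, v, w}}"

lemma simple_graph_edgeD:
  assumes "simple_graph V E" "{u, v} \<in> E"
  shows "u \<in> V" "v \<in> V" "u \<noteq> v"
  using assms by (auto simp: simple_graph_def nsets_def)

lemma ordered_cherriesD:
  assumes "simple_graph V E" "(u, v, w) \<in> ordered_cherries E"
  shows "u \<in> V" "v \<in> V" "w \<in> V" "u \<noteq> v" "v \<noteq> w" "u \<noteq> w"
  using assms simple_graph_edgeD[OF assms(1)] by (auto simp: ordered_cherries_def)

lemma finite_ordered_cherries:
  assumes "simple_graph V E"
  shows "finite (ordered_cherries E)"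
  by (rule finite_subset[of _ "V \<times> V \<times> V"])
    (use assms ordered_cherriesD[OF assms] in \<open>auto simp: simple_graph_def\<close>)

lemma finite_neighbours:
  assumes "simple_graph V E"
  shows "finite (neighbours E v)"
  by (rule finite_subset[of _ V])
    (use assms simple_graph_edgeD[OF assms] in \<open>auto simp: simple_graph_def neighbours_def\<close>)

text \<open>The centre of a cherry is recovered as the common vertex of its two edges, so only the
  order of the leaves is free.\<close>

lemma card_ordered_cherries_le:
  assumes G: "simple_graph V E"
  shows "card (ordered_cherries E) \<le> 2 * card (cherries V E)"
proof -
  define \<phi> where "\<phi> = (\<lambda>(u :: 'a, v, w). ({u, v, w}, {{u, v}, {v, w}}))"
  have two: "card {a, b} \<le> 2" for a b :: "'a \<times> 'a \<times> 'a"
    by (simp add: card_insert_if)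
  have "finite (Pow V \<times> Pow E)"
    using G finite_subset[of E "Pow V"] by (auto simp: simple_graph_def nsets_def)
  then have fin: "finite (cherries V E)"
    by (rule rev_finite_subset) (auto simp: cherries_def)
  have "\<phi> t \<in> cherries V E" if "t \<in> ordered_cherries E" for t
  proof -
    obtain u v w where t: "t = (u, v, w)"
      by (cases t)
    note d = ordered_cherriesD[OF G that[unfolded t]]
    have "distinct [u, v, w]" "{u, v, w} \<subseteq> V" "{{u, v}, {v, w}} \<subseteq> E"
      using d that by (auto simp: t ordered_cherries_def)
    then show ?thesis
      unfolding t \<phi>_def cherries_def mem_Collect_eq case_prod_conv
      by (intro conjI exI[of _ u] exI[of _ v] exI[of _ w]) simp_all
  qed
  then have "ordered_cherries E \<subseteq> (\<Union>y\<in>cherries V E. {t \<in> ordered_cherries E. \<phi> t = y})"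
    by blast
  then have "card (ordered_cherries E) \<le> card (\<Union>y\<in>cherries V E. {t \<in> ordered_cherries E. \<phi> t = y})"
    by (rule card_mono[rotated]) (use fin finite_ordered_cherries[OF G] in simp)
  also have "\<dots> \<le> (\<Sum>y\<in>cherries V E. card {t \<in> ordered_cherries E. \<phi> t = y})"
    by (rule card_UN_le[OF fin])
  also have "\<dots> \<le> (\<Sum>y\<in>cherries V E. 2)"
  proof (rule sum_mono)
    fix y assume "y \<in> cherries V E"
    then obtain u v w where y: "distinct [u, v, w]" "y = ({u, v, w}, {{u, v}, {v, w}})"
      by (auto simp: cherries_def)
    have "{t \<in> ordered_cherries E. \<phi> t = y} \<subseteq> {(u, v, w), (w, v, u)}"
      using y by (auto simp: \<phi>_def doubleton_eq_iff)
    then have "card {t \<in> ordered_cherries E. \<phi> t = y} \<le> card {(u, v, w), (w, v, u)}"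
      by (rule card_mono[rotated]) simp
    also have "\<dots> \<le> 2"
      by (rule two)
    finally show "card {t \<in> ordered_cherries E. \<phi> t = y} \<le> 2" .
  qed
  finally show ?thesis
    by simp
qed

text \<open>Choose the centre first, then an ordered pair of distinct neighbours. For degree 0 the
  truncated \<open>- 1\<close> is harmless because the other factor vanishes.\<close>

lemma card_ordered_cherries_eq:
  assumes G: "simple_graph V E"
  shows "card (ordered_cherries E) = (\<Sum>v\<in>V. card (neighbours E v) * (card (neighbours E v) - 1))"
proof -
  let ?A = "SIGMA v:V. SIGMA u:neighbours E v. neighbours E v - {u}"
  let ?\<phi> = "\<lambda>(v, u, w). (u, v, w)"
  have "finite V"
    using G by (simp add: simple_graph_def)
  have "ordered_cherries E = ?\<phi> ` ?A"
  proof (intro equalityI subsetI)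
    fix t assume t: "t \<in> ordered_cherries E"
    obtain u v w where uvw: "t = (u, v, w)"
      by (cases t)
    have "(v, u, w) \<in> ?A"
      using t ordered_cherriesD[OF G t[unfolded uvw]]
      by (auto simp: uvw ordered_cherries_def neighbours_def insert_commute)
    then show "t \<in> ?\<phi> ` ?A"
      unfolding uvw by force
  qed (auto simp: ordered_cherries_def neighbours_def insert_commute)
  moreover have "inj_on ?\<phi> ?A"
    by (auto simp: inj_on_def)
  ultimately have "card (ordered_cherries E) = card ?A"
    by (simp add: card_image)
  also have "\<dots> = (\<Sum>v\<in>V. \<Sum>u\<in>neighbours E v. card (neighbours E v) - 1)"
    using \<open>finite V\<close> finite_neighbours[OF G] by (simp add: card_Diff_singleton)
  finally show ?thesis
    by simp
qed

lemma card_leaf_cherries_eq: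
  assumes G: "simple_graph V E"
  shows "card {(v, w). (u, v, w) \<in> ordered_cherries E} =
    (\<Sum>v\<in>neighbours E u. card (neighbours E v) - 1)"
proof -
  have "{(v, w). (u, v, w) \<in> ordered_cherries E} = (SIGMA v:neighbours E u. neighbours E v - {u})"
    by (auto simp: ordered_cherries_def neighbours_def insert_commute)
  moreover have "card \<dots> = (\<Sum>v\<in>neighbours E u. card (neighbours E v - {u}))"
    using finite_neighbours[OF G] by simp
  moreover have "\<dots> = (\<Sum>v\<in>neighbours E u. card (neighbours E v) - 1)"
    by (intro sum.cong refl card_Diff_singleton)
      (auto simp: neighbours_def insert_commute)
  ultimately show ?thesis
    by simp
qed

text \<open>The centre \<open>v\<close> alone accounts for \<open>d * (d - 1)\<close> ordered
  cherries, which is at least \<open>d ^ 2 / 2\<close> once \<open>d \<ge> 2\<close>. Smaller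
  degrees are covered by \<open>1 \<le> s\<close>.\<close>

lemma degree_le:
  fixes s :: real
  assumes G: "simple_graph V E" and s: "1 \<le> s" and T: "real (card (ordered_cherries E)) \<le> 2 * s ^ 4"
    and v: "v \<in> V"
  shows "real (card (neighbours E v)) \<le> 2 * s ^ 2"
proof (cases "card (neighbours E v) \<le> 1")
  case True
  moreover have "1 \<le> s ^ 2"
    using s by simp
  ultimately show ?thesis
    by linarith
next
  case False
  define d where "d = card (neighbours E v)"
  have "d * (d - 1) \<le> card (ordered_cherries E)"
    unfolding d_def card_ordered_cherries_eq[OF G]
    by (rule member_le_sum[OF v]) (use G in \<open>auto simp: simple_graph_def\<close>)
  then have "real (d * (d - 1)) \<le> 2 * s ^ 4"
    using T by linarith
  moreover have "d \<ge> 2" "real (d - 1) = real d - 1"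
    using False by (auto simp: d_def)
  ultimately have "real d * (real d - 1) \<le> 2 * s ^ 4"
    by (simp only: of_nat_mult)
  moreover have "real d * real d \<le> 2 * (real d * (real d - 1))"
    using \<open>d \<ge> 2\<close> by (simp add: algebra_simps)
  ultimately have "(real d) ^ 2 \<le> (2 * s ^ 2) ^ 2"
    by (simp add: power2_eq_square power4_eq_xxxx)
  then show ?thesis
    unfolding d_def by (rule power2_le_imp_le) simp
qed

text \<open>After multiplication by \<open>2 * s\<close>, AM-GM leaves \<open>s ^ 2\<close> per
  neighbour of \<open>u\<close>, at most \<open>2 * s ^ 4\<close> by \<open>degree_le\<close>, plus
  the ordered cherries centred at those neighbours, again at most \<open>2 * s ^ 4\<close>. The gain
  of a factor \<open>s\<close> over counting all ordered cherries matters for heavy leaves.\<close>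

lemma card_leaf_cherries_le:
  fixes s :: real
  assumes G: "simple_graph V E" and s: "1 \<le> s" and T: "real (card (ordered_cherries E)) \<le> 2 * s ^ 4"
    and u: "u \<in> V"
  shows "real (card {(v, w). (u, v, w) \<in> ordered_cherries E}) \<le> 2 * s ^ 3"
proof -
  define d where "d v = card (neighbours E v)" for v
  have fin: "finite V" and sub: "neighbours E u \<subseteq> V"
    using G simple_graph_edgeD[OF G] by (auto simp: simple_graph_def neighbours_def)
  \<comment> \<open>AM-GM, balanced at \<open>d v - 1 = s\<close>\<close>
  have amgm: "2 * s * real (d v - 1) \<le> s ^ 2 + real (d v * (d v - 1))" for v
  proof -
    have "2 * s * real (d v - 1) \<le> s ^ 2 + real (d v - 1) ^ 2"
      using zero_le_power2[of "s - real (d v - 1)"] by (simp add: power2_eq_square algebra_simps)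
    moreover have "real (d v - 1) ^ 2 \<le> real (d v * (d v - 1))"
      unfolding power2_eq_square of_nat_mult by (intro mult_right_mono) auto
    ultimately show ?thesis
      by linarith
  qed
  have "2 * s * real (\<Sum>v\<in>neighbours E u. d v - 1) = (\<Sum>v\<in>neighbours E u. 2 * s * real (d v - 1))"
    by (simp add: sum_distrib_left)
  also have "\<dots> \<le> (\<Sum>v\<in>neighbours E u. s ^ 2 + real (d v * (d v - 1)))"
    by (intro sum_mono amgm)
  also have "\<dots> = s ^ 2 * real (d u) + (\<Sum>v\<in>neighbours E u. real (d v * (d v - 1)))"
    by (simp add: sum.distrib d_def)
  also have "(\<Sum>v\<in>neighbours E u. real (d v * (d v - 1))) \<le> (\<Sum>v\<in>V. real (d v * (d v - 1)))"
    by (rule sum_mono2[OF fin sub]) simp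
  also have "\<dots> = real (card (ordered_cherries E))"
    by (simp add: card_ordered_cherries_eq[OF G] d_def)
  also note T
  also have "s ^ 2 * real (d u) \<le> s ^ 2 * (2 * s ^ 2)"
    unfolding d_def by (intro mult_left_mono degree_le[OF G s T u]) simp
  finally have "2 * s * real (\<Sum>v\<in>neighbours E u. d v - 1) \<le> 2 * s * (2 * s ^ 3)"
    by (simp add: power2_eq_square power3_eq_cube power4_eq_xxxx)
  then have "real (\<Sum>v\<in>neighbours E u. d v - 1) \<le> 2 * s ^ 3"
    by (rule mult_left_le_imp_le) (use s in simp)
  then show ?thesis
    by (simp add: card_leaf_cherries_eq[OF G] d_def)
qed

lemma sum_card_ordered_cherries_at:
  assumes G: "simple_graph V E"
  shows "(\<Sum>a\<in>V. card (ordered_cherries_at E a)) = 3 * card (ordered_cherries E)"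
proof -
  have "ordered_cherries_at E a = {t \<in> ordered_cherries E. case t of (u, v, w) \<Rightarrow> a \<in> {u, v, w}}" for a
    by (auto simp: ordered_cherries_at_def)
  moreover have "(\<Sum>a\<in>V. card {t \<in> ordered_cherries E. case t of (u, v, w) \<Rightarrow> a \<in> {u, v, w}}) =
      3 * card (ordered_cherries E)"
  proof (rule sum_multicount)
    show "\<forall>t\<in>ordered_cherries E. card {a \<in> V. case t of (u, v, w) \<Rightarrow> a \<in> {u, v, w}} = 3"
    proof
      fix t assume t: "t \<in> ordered_cherries E"
      obtain u v w where uvw: "t = (u, v, w)"
        by (cases t)
      note d = ordered_cherriesD[OF G t[unfolded uvw]]
      have "{a \<in> V. case t of (u, v, w) \<Rightarrow> a \<in> {u, v, w}} = {u, v, w}"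
        using d by (auto simp: uvw)
      then show "card {a \<in> V. case t of (u, v, w) \<Rightarrow> a \<in> {u, v, w}} = 3"
        using d by simp
    qed
  qed (use G finite_ordered_cherries[OF G] in \<open>auto simp: simple_graph_def\<close>)
  ultimately show ?thesis
    by simp
qed

text \<open>Markov's inequality: every ordered cherry has three vertices, so the counts add up to at
  most \<open>6 * s ^ 4\<close>.\<close>

lemma card_heavy_le:
  fixes s :: real
  assumes G: "simple_graph V E" and s: "1 \<le> s" and T: "real (card (ordered_cherries E)) \<le> 2 * s ^ 4"
  shows "real (card {a \<in> V. real (card (ordered_cherries_at E a)) > 6 * s ^ 3}) \<le> s"
proof -
  let ?S = "{a \<in> V. real (card (ordered_cherries_at E a)) > 6 * s ^ 3}"
  have fin: "finite V"
    using G by (simp add: simple_graph_def)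
  have "real (card ?S) * (6 * s ^ 3) = (\<Sum>a\<in>?S. 6 * s ^ 3)"
    by simp
  also have "\<dots> \<le> (\<Sum>a\<in>?S. real (card (ordered_cherries_at E a)))"
    by (rule sum_mono) auto
  also have "\<dots> \<le> (\<Sum>a\<in>V. real (card (ordered_cherries_at E a)))"
    by (rule sum_mono2) (use fin in auto)
  also have "\<dots> = real (3 * card (ordered_cherries E))"
    unfolding sum_card_ordered_cherries_at[OF G, symmetric] by simp
  also have "\<dots> \<le> s * (6 * s ^ 3)"
    using T by (simp add: power3_eq_cube power4_eq_xxxx)
  finally show ?thesis
    by (rule mult_right_le_imp_le) (use s in simp)
qed

section \<open>Monochromatic cherries\<close>

definition mono_ends :: "nat \<Rightarrow> (nat set \<Rightarrow> 'c) \<Rightarrow> nat \<Rightarrow> nat \<Rightarrow> nat set" where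
  "mono_ends n c x y = {z. z < n \<and> z \<noteq> x \<and> z \<noteq> y \<and> c {x, y} = c {y, z}}"

definition mono_centres :: "nat \<Rightarrow> (nat set \<Rightarrow> 'c) \<Rightarrow> nat \<Rightarrow> nat \<Rightarrow> nat set" where
  "mono_centres n c x z = {y. y < n \<and> y \<noteq> x \<and> y \<noteq> z \<and> c {x, y} = c {y, z}}"

lemma finite_mono_ends [simp]: "finite (mono_ends n c x y)"
  by (rule finite_subset[of _ "{..<n}"]) (auto simp: mono_ends_def)

lemma finite_mono_centres [simp]: "finite (mono_centres n c x z)"
  by (rule finite_subset[of _ "{..<n}"]) (auto simp: mono_centres_def)

lemma mono_centres_commute: "mono_centres n c x z = mono_centres n c z x"
  by (auto simp: mono_centres_def insert_commute)

text \<open>The colour \<open>c {x, y}\<close> merely names one colour, and the ends inject into the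
  edges of that colour at \<open>y\<close>. This includes \<open>x = y\<close>, where a singleton is
  coloured, so later sums may run over all pairs.\<close>

lemma card_mono_ends_le:
  assumes "locally_bounded n k c" "y < n"
  shows "real (card (mono_ends n c x y)) \<le> k"
proof -
  let ?F = "{e \<in> complete_edges n. y \<in> e \<and> c e = c {x, y}}"
  have fin: "finite ?F"
    by (rule finite_subset[of _ "Pow {..<n}"]) (auto simp: complete_edges_def nsets_def)
  have "inj_on (\<lambda>z. {y, z}) (mono_ends n c x y)"
    by (auto simp: inj_on_def doubleton_eq_iff)
  moreover have "(\<lambda>z. {y, z}) ` mono_ends n c x y \<subseteq> ?F"
    using assms(2) by (auto simp: mono_ends_def complete_edges_def nsets_def)
  ultimately have "card (mono_ends n c x y) \<le> card ?F"
    using fin by (rule card_inj_on_le)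
  moreover have "real (card ?F) \<le> k"
    using assms unfolding locally_bounded_def by blast
  ultimately show ?thesis
    by linarith
qed

lemma card_Sigma_le:
  fixes K :: real
  assumes "finite A" "\<And>a. a \<in> A \<Longrightarrow> finite (B a)" "\<And>a. a \<in> A \<Longrightarrow> real (card (B a)) \<le> K"
  shows "real (card (Sigma A B)) \<le> real (card A) * K"
  using assms sum_mono[of A "\<lambda>a. real (card (B a))" "\<lambda>_. K"] by simp

text \<open>Double counting of the monochromatic cherries with leaf \<open>x\<close>: listed by
  centre instead of by second leaf, each of the \<open>n\<close> centres has at most
  \<open>k\<close> ends.\<close>

lemma sum_card_mono_centres_le:
  assumes lb: "locally_bounded n k c"
  shows "(\<Sum>z\<in>{..<n} - {x}. real (card (mono_centres n c x z))) \<le> real n * k"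
proof -
  let ?A = "SIGMA z:{..<n} - {x}. mono_centres n c x z"
  let ?B = "SIGMA y:{..<n}. mono_ends n c x y"
  have "(\<Sum>z\<in>{..<n} - {x}. real (card (mono_centres n c x z))) = real (card ?A)"
    by simp
  also have "card ?A \<le> card ?B"
  proof (rule card_inj_on_le)
    show "inj_on prod.swap ?A"
      by (auto simp: inj_on_def)
    show "prod.swap ` ?A \<subseteq> ?B"
      by (auto simp: mono_centres_def mono_ends_def)
  qed simp
  also have "real (card ?B) \<le> real (card {..<n}) * k"
    by (rule card_Sigma_le) (use card_mono_ends_le[OF lb] in auto)
  finally show ?thesis
    by simp
qed

lemma card_many_centres_le:
  assumes lb: "locally_bounded n k c" and k: "0 < k" and D: "0 < D"
  shows "real (card {z \<in> {..<n} - {x}. D * k < real (card (mono_centres n c x z))}) \<le> real n / D"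
proof -
  let ?Z = "{z \<in> {..<n} - {x}. D * k < real (card (mono_centres n c x z))}"
  have "real (card ?Z) * (D * k) = (\<Sum>z\<in>?Z. D * k)"
    by simp
  also have "\<dots> \<le> (\<Sum>z\<in>?Z. real (card (mono_centres n c x z)))"
    by (rule sum_mono) auto
  also have "\<dots> \<le> (\<Sum>z\<in>{..<n} - {x}. real (card (mono_centres n c x z)))"
    by (rule sum_mono2) auto
  also have "\<dots> \<le> real n * k"
    by (rule sum_card_mono_centres_le[OF lb])
  finally have "(real (card ?Z) * D) * k \<le> real n * k"
    by (simp add: mult_ac)
  then have "real (card ?Z) * D \<le> real n"
    using k by (rule mult_right_le_imp_le)
  then show ?thesis
    using D by (simp add: field_simps)
qed

section \<open>Greedy construction of the images of the heavy vertices\<close>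

definition spread :: "nat \<Rightarrow> (nat set \<Rightarrow> 'c) \<Rightarrow> real \<Rightarrow> nat set \<Rightarrow> bool" where
  "spread n c D P \<longleftrightarrow> P \<subseteq> {..<n} \<and>
     (\<forall>x\<in>P. \<forall>y\<in>P. x \<noteq> y \<longrightarrow> real (card (mono_centres n c x y)) \<le> D) \<and>
     (\<forall>x\<in>P. \<forall>y\<in>P. x \<noteq> y \<longrightarrow> mono_ends n c x y \<inter> P = {})"

lemma card_UN_le_mult:
  fixes K :: real
  assumes "finite A" "0 \<le> K" "\<And>a. a \<in> A \<Longrightarrow> real (card (B a)) \<le> K" "real (card A) \<le> M"
  shows "real (card (\<Union>a\<in>A. B a)) \<le> M * K"
proof -
  have "real (card (\<Union>a\<in>A. B a)) \<le> (\<Sum>a\<in>A. real (card (B a)))"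
    using card_UN_le[OF assms(1), of B] by (simp only: of_nat_sum[symmetric] of_nat_le_iff)
  also have "\<dots> \<le> (\<Sum>a\<in>A. K)"
    by (rule sum_mono) (rule assms(3))
  also have "\<dots> \<le> M * K"
    using mult_right_mono[OF assms(4,2)] by simp
  finally show ?thesis .
qed

text \<open>Points are added one at a time. The points unsuitable as the next one number at most
  \<open>4 * s ^ 3 * k + n / 2\<close>, which is less than \<open>n\<close>.\<close>

lemma ex_spread_set:
  fixes s k :: real
  assumes lb: "locally_bounded n k c" and k: "1 \<le> k" and s: "1 \<le> s" and n: "560 * s ^ 3 * k \<le> real n"
    and m: "real m \<le> s"
  shows "\<exists>P. spread n c (2 * s * k) P \<and> card P = m"
  using m
proof (induction m)
  case 0
  have "spread n c (2 * s * k) {}"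
    by (simp add: spread_def)
  then show ?case
    by (intro exI[of _ "{}"]) simp
next
  case (Suc m)
  then obtain P where P: "spread n c (2 * s * k) P" "card P = m"
    by auto
  have ms: "real (card P) \<le> s" and fin: "finite P"
    using Suc.prems P finite_subset[of P "{..<n}"] by (auto simp: spread_def)
  define Pr where "Pr = {(x, y) \<in> P \<times> P. x \<noteq> y}"
  have finPr: "finite Pr"
    by (rule finite_subset[of _ "P \<times> P"]) (use fin in \<open>auto simp: Pr_def\<close>)
  have "card Pr \<le> card (P \<times> P)"
    by (rule card_mono) (use fin in \<open>auto simp: Pr_def\<close>)
  then have "real (card Pr) \<le> real (card P) * real (card P)"
    by (simp add: card_cartesian_product flip: of_nat_mult)
  also have "\<dots> \<le> s * s"
    using ms s by (intro mult_mono) auto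
  finally have cPr: "real (card Pr) \<le> s * s" .
  \<comment> \<open>A point of \<open>B1\<close> or \<open>B2\<close> would complete a monochromatic
    cherry with two points of \<open>P\<close>, as a leaf or as the centre. A point of
    \<open>B3\<close> shares too many centres with a point of \<open>P\<close>; the threshold
    \<open>2 * s\<close> is chosen so that \<open>s\<close> sets of size \<open>n / (2 * s)\<close>
    cover only half of the vertices.\<close>
  define B1 where "B1 = (\<Union>t\<in>Pr. mono_ends n c (fst t) (snd t))"
  define B2 where "B2 = (\<Union>t\<in>Pr. mono_centres n c (fst t) (snd t))"
  define B3 where "B3 = (\<Union>x\<in>P. {z \<in> {..<n} - {x}. (2 * s) * k < real (card (mono_centres n c x z))})"
  have 1: "real (card B1) \<le> (s * s) * k"
    unfolding B1_def
    by (rule card_UN_le_mult[OF finPr _ card_mono_ends_le[OF lb] cPr])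
      (use k P in \<open>auto simp: Pr_def spread_def\<close>)
  have 2: "real (card B2) \<le> (s * s) * (2 * s * k)"
    unfolding B2_def
    by (rule card_UN_le_mult[OF finPr _ _ cPr]) (use s k P in \<open>auto simp: Pr_def spread_def\<close>)
  have "real (card B3) \<le> s * (real n / (2 * s))"
    unfolding B3_def
    by (rule card_UN_le_mult[OF fin _ card_many_centres_le[OF lb] ms]) (use s k in auto)
  then have 3: "real (card B3) \<le> real n / 2"
    using s by simp
  have "real (card (P \<union> B1 \<union> B2 \<union> B3)) \<le> real (card P) + real (card B1) + real (card B2) + real (card B3)"
    using card_Un_le[of "P \<union> B1 \<union> B2" B3] card_Un_le[of "P \<union> B1" B2] card_Un_le[of P B1] by linarith
  also have "\<dots> \<le> s + (s * s) * k + (s * s) * (2 * s * k) + real n / 2"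
    using ms 1 2 3 by linarith
  also have "\<dots> < real n"
  proof -
    have "s \<le> s ^ 3 * k" "(s * s) * k \<le> s ^ 3 * k"
    proof -
      have "s ^ 1 * 1 \<le> s ^ 3 * k"
        using s k by (intro mult_mono power_increasing) auto
      then show "s \<le> s ^ 3 * k" by simp
      have "s ^ 2 * k \<le> s ^ 3 * k"
        using s k by (intro mult_right_mono power_increasing) auto
      then show "(s * s) * k \<le> s ^ 3 * k"
        by (simp add: power2_eq_square)
    qed
    moreover have "(s * s) * (2 * s * k) = 2 * (s ^ 3 * k)"
      by (simp add: power3_eq_cube)
    moreover have "560 * (s ^ 3 * k) \<le> real n"
      using n by simp
    moreover have "0 < s ^ 3 * k"
      using s k by simp
    ultimately show ?thesis
      by linarith
  qed
  finally have "card (P \<union> B1 \<union> B2 \<union> B3) < card {..<n}"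
    by simp
  moreover have "finite (P \<union> B1 \<union> B2 \<union> B3)"
    using fin finPr by (simp add: B1_def B2_def B3_def)
  ultimately obtain p where p: "p < n" "p \<notin> P" "p \<notin> B1" "p \<notin> B2" "p \<notin> B3"
    by (metis UnCI card_mono lessThan_iff linorder_not_less subsetI)
  have "spread n c (2 * s * k) (insert p P)"
    unfolding spread_def
  proof (intro conjI ballI impI)
    show "insert p P \<subseteq> {..<n}"
      using p P by (auto simp: spread_def)
    have pc: "real (card (mono_centres n c x p)) \<le> 2 * s * k" if "x \<in> P" for x
      using that p by (force simp: B3_def not_less)
    show "real (card (mono_centres n c x y)) \<le> 2 * s * k"
      if "x \<in> insert p P" "y \<in> insert p P" "x \<noteq> y" for x y
      using that pc P(1) by (auto simp: spread_def mono_centres_commute[of n c p])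
    show "mono_ends n c x y \<inter> insert p P = {}"
      if xy: "x \<in> insert p P" "y \<in> insert p P" "x \<noteq> y" for x y
    proof (rule ccontr)
      assume "mono_ends n c x y \<inter> insert p P \<noteq> {}"
      then obtain z where z: "z \<in> mono_ends n c x y" "z \<in> insert p P"
        by blast
      then have zd: "z \<noteq> x" "z \<noteq> y" "c {x, y} = c {y, z}" "z < n"
        by (auto simp: mono_ends_def)
      \<comment> \<open>The three vertices are distinct, so at most one of them is the new point
        \<open>p\<close>.\<close>
      consider "x \<in> P" "y \<in> P" "z \<in> P" | "x = p" "y \<in> P" "z \<in> P" | "y = p" "x \<in> P" "z \<in> P"
        | "z = p" "x \<in> P" "y \<in> P"
        using xy z zd by blast
      then show False
      proof cases
        case 1
        then show ?thesis
          using P(1) xy(3) z(1) unfolding spread_def by blast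
      next
        case 2
        then have "p \<in> mono_ends n c z y" "(z, y) \<in> Pr"
          using zd p by (auto simp: mono_ends_def Pr_def insert_commute)
        then show ?thesis
          using p by (force simp: B1_def)
      next
        case 3
        then have "p \<in> mono_centres n c x z" "(x, z) \<in> Pr"
          using zd p by (auto simp: mono_centres_def Pr_def)
        then show ?thesis
          using p by (force simp: B2_def)
      next
        case 4
        then have "p \<in> mono_ends n c x y" "(x, y) \<in> Pr"
          using z xy by (auto simp: Pr_def)
        then show ?thesis
          using p by (force simp: B1_def)
      qed
    qed
  qed
  moreover have "card (insert p P) = Suc m"
    using fin p P by simp
  ultimately show ?case
    by blast
qed

text \<open>When the sets are added one by one, a set meets the union of \<open>m\<close> earlier
  ones in at most \<open>m * D\<close> points, and these losses sum to at most the square of the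
  number of sets times \<open>D\<close>.\<close>

lemma sum_card_le_of_small_intersections:
  fixes D :: real
  assumes "finite I" "\<And>i. i \<in> I \<Longrightarrow> finite (Y i)" "0 \<le> D"
    and "\<And>i j. i \<in> I \<Longrightarrow> j \<in> I \<Longrightarrow> i \<noteq> j \<Longrightarrow> real (card (Y i \<inter> Y j)) \<le> D"
  shows "(\<Sum>i\<in>I. real (card (Y i))) \<le> real (card (\<Union>i\<in>I. Y i)) + real (card I) ^ 2 * D"
  using assms(1,2,4)
proof (induction I rule: finite_induct)
  case (insert i I)
  let ?U = "\<Union>j\<in>I. Y j"
  have "card (Y i) + card ?U = card (Y i \<union> ?U) + card (Y i \<inter> ?U)"
    by (rule card_Un_Int) (use insert in auto)
  moreover have "real (card (Y i \<inter> ?U)) \<le> real (card I) * D"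
  proof -
    have "Y i \<inter> ?U = (\<Union>j\<in>I. Y i \<inter> Y j)"
      by blast
    then show ?thesis
      using card_UN_le_mult[of I D "\<lambda>j. Y i \<inter> Y j" "real (card I)"] insert assms(3) by fastforce
  qed
  moreover have "(\<Sum>j\<in>I. real (card (Y j))) \<le> real (card ?U) + real (card I) ^ 2 * D"
    using insert by simp
  moreover have "real (card I) ^ 2 * D + real (card I) * D \<le> real (card (insert i I)) ^ 2 * D"
    using insert assms(3) by (simp add: power2_eq_square algebra_simps)
  ultimately show ?case
    using insert by simp
qed simp

lemma spread_sum_mono_centres_le:
  assumes P: "spread n c D P" and D: "0 \<le> D"
  shows "(\<Sum>x\<in>P. real (card (mono_centres n c x b))) \<le> real n + real (card P) ^ 2 * D"
proof -
  have fin: "finite P"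
    using P finite_subset[of P "{..<n}"] by (auto simp: spread_def)
  have "(\<Sum>x\<in>P. real (card (mono_centres n c x b))) \<le>
      real (card (\<Union>x\<in>P. mono_centres n c x b)) + real (card P) ^ 2 * D"
  proof (rule sum_card_le_of_small_intersections[OF fin _ D])
    fix x y assume xy: "x \<in> P" "y \<in> P" "x \<noteq> y"
    \<comment> \<open>A common element is joined to \<open>x\<close>, \<open>b\<close> and
      \<open>y\<close> by edges of a single colour, hence it is a centre for \<open>x\<close> and
      \<open>y\<close>.\<close>
    have "card (mono_centres n c x b \<inter> mono_centres n c y b) \<le> card (mono_centres n c x y)"
      by (rule card_mono) (auto simp: mono_centres_def insert_commute)
    then show "real (card (mono_centres n c x b \<inter> mono_centres n c y b)) \<le> D"
      using P xy by (force simp: spread_def)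
  qed simp
  moreover have "card (\<Union>x\<in>P. mono_centres n c x b) \<le> card {..<n}"
    by (rule card_mono) (auto simp: mono_centres_def)
  ultimately show ?thesis
    by simp
qed

section \<open>Extending an embedding of the heavy vertices\<close>

lemma card_image_Sigma_le:
  fixes K M :: real
  assumes "X \<subseteq> \<phi> ` Sigma A B" "finite A" "\<And>a. a \<in> A \<Longrightarrow> finite (B a)"
    and "\<And>a. a \<in> A \<Longrightarrow> real (card (B a)) \<le> K" "real (card A) \<le> M" "0 \<le> K"
  shows "real (card X) \<le> M * K"
proof -
  have fin: "finite (Sigma A B)"
    using assms by blast
  have "card X \<le> card (\<phi> ` Sigma A B)"
    by (rule card_mono[OF _ assms(1)]) (use fin in simp)
  also have "\<dots> \<le> card (Sigma A B)"
    by (rule card_image_le[OF fin])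
  finally have "real (card X) \<le> real (card (Sigma A B))"
    by simp
  also have "\<dots> \<le> real (card A) * K"
    by (rule card_Sigma_le) (use assms in auto)
  also have "\<dots> \<le> M * K"
    by (rule mult_right_mono) (use assms in auto)
  finally show ?thesis .
qed

text \<open>In the names below, the letters \<open>h\<close> and \<open>l\<close> record which of the vertices of a cherry, listed as
  leaf, centre, leaf, are heavy (embedded by \<open>g\<close>) and which are light.\<close>

locale heavy_embedding =
  fixes n :: nat and k s :: real and V :: "'a set" and E :: "'a set set" and c :: "nat set \<Rightarrow> 'c"
    and S :: "'a set" and P :: "nat set" and g :: "'a \<Rightarrow> nat"
  assumes G: "simple_graph V E" and cardV: "card V = n"
    and lb: "locally_bounded n k c" and k1: "1 \<le> k" and s1: "1 \<le> s"
    and nbig: "560 * s ^ 3 * k \<le> real n"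
    and T: "real (card (ordered_cherries E)) \<le> 2 * s ^ 4"
    and S: "S \<subseteq> V" "real (card S) \<le> s"
    and light: "\<And>a. a \<in> V - S \<Longrightarrow> real (card (ordered_cherries_at E a)) \<le> 6 * s ^ 3"
    and P: "spread n c (2 * s * k) P" and g: "bij_betw g S P"
begin

section \<open>The bad events for a random embedding of the light vertices\<close>

definition L :: "'a set" where "L = V - S"
definition Q :: "nat set" where "Q = {..<n} - P"

text \<open>The case of \<open>a\<close> as the first leaf is covered by the reversed ordered
  cherry. Keeping the heavy vertices under the quantifiers merges all cherries that exclude the same
  image of \<open>a\<close> into a single event.\<close>

definition forbidden :: "'a \<Rightarrow> nat \<Rightarrow> bool" where
  "forbidden a z \<longleftrightarrow>
     (\<exists>u\<in>S. \<exists>v\<in>S. (u, v, a) \<in> ordered_cherries E \<and> z \<in> mono_ends n c (g u) (g v)) \<or>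
     (\<exists>u\<in>S. \<exists>w\<in>S. (u, a, w) \<in> ordered_cherries E \<and> z \<in> mono_centres n c (g u) (g w))"

definition ev1 :: "('a \<times> nat) set set" where
  "ev1 = {{(a, z)} | a z. a \<in> L \<and> z \<in> Q \<and> forbidden a z}"

definition ev_lhl :: "('a \<times> nat) set set" where
  "ev_lhl = {{(u, x), (w, z)} | u v w x z. (u, v, w) \<in> ordered_cherries E \<and> u \<in> L \<and> v \<in> S \<and> w \<in> L \<and>
     x \<in> Q \<and> z \<in> Q \<and> z \<in> mono_ends n c x (g v)}"

text \<open>Cherries whose heavy leaf comes last enter here through their reversal.\<close>

definition ev_hll :: "('a \<times> nat) set set" where
  "ev_hll = {{(v, y), (w, z)} | u v w y z. (u, v, w) \<in> ordered_cherries E \<and> u \<in> S \<and> v \<in> L \<and> w \<in> L \<and>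
     y \<in> Q \<and> z \<in> Q \<and> z \<in> mono_ends n c (g u) y}"

text \<open>The condition \<open>x \<noteq> y\<close> makes the three pairs a partial injection,
  since \<open>mono_ends\<close> only separates \<open>z\<close> from \<open>x\<close> and
  \<open>y\<close>. In the other kinds a heavy image lies in \<open>P\<close> and is thereby
  distinct from the light ones.\<close>

definition ev_lll :: "('a \<times> nat) set set" where
  "ev_lll = {{(u, x), (v, y), (w, z)} | u v w x y z. (u, v, w) \<in> ordered_cherries E \<and>
     u \<in> L \<and> v \<in> L \<and> w \<in> L \<and> x \<in> Q \<and> y \<in> Q \<and> z \<in> Q \<and> x \<noteq> y \<and> z \<in> mono_ends n c x y}"

definition events :: "('a \<times> nat) set set" where
  "events = ev1 \<union> ev_lhl \<union> ev_hll \<union> ev_lll"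

lemma finite_S: "finite S" and finite_P: "finite P" and P_sub: "P \<subseteq> {..<n}"
  and card_P: "real (card P) \<le> s" and finite_V: "finite V"
proof -
  show "finite V"
    using G by (simp add: simple_graph_def)
  then show "finite S"
    using S finite_subset by blast
  show "P \<subseteq> {..<n}"
    using P by (simp add: spread_def)
  then show "finite P"
    using finite_subset by blast
  show "real (card P) \<le> s"
    using S(2) bij_betw_same_card[OF g] by simp
qed

lemma gP: "u \<in> S \<Longrightarrow> g u \<in> P"
  using g by (auto simp: bij_betw_def)

lemma g_less: "u \<in> S \<Longrightarrow> g u < n"
  using gP P_sub by blast

lemma finite_T: "finite (ordered_cherries E)"
  by (rule finite_ordered_cherries[OF G])

lemma finite_T_at: "finite (ordered_cherries_at E a)"
  by (rule finite_subset[OF _ finite_T]) (auto simp: ordered_cherries_at_def)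

lemma k0: "0 \<le> k"
  using k1 by simp

lemmas ends_le = card_mono_ends_le[OF lb]

lemma mono_ends_commute: "z < n \<Longrightarrow> x < n \<Longrightarrow> z \<in> mono_ends n c x y \<Longrightarrow> x \<noteq> y \<Longrightarrow> x \<in> mono_ends n c z y"
  by (auto simp: mono_ends_def insert_commute)

section \<open>Counting the events at a given light vertex\<close>

lemma card_ev1_at:
  assumes a: "a \<in> L"
  shows "real (card {e \<in> ev1. a \<in> fst ` e}) \<le> 8 * (s ^ 3 * k)"
proof -
  let ?A = "{t \<in> ordered_cherries_at E a. fst t \<in> S \<and> fst (snd t) \<in> S}"
  let ?B = "{t \<in> P \<times> P. fst t \<noteq> snd t}"
  let ?X = "\<Union>t\<in>?A. mono_ends n c (g (fst t)) (g (fst (snd t)))"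
  let ?Y = "\<Union>t\<in>?B. mono_centres n c (fst t) (snd t)"
  have "{e \<in> ev1. a \<in> fst ` e} \<subseteq> (\<lambda>z. {(a, z)}) ` (?X \<union> ?Y)"
  proof
    fix e assume "e \<in> {e \<in> ev1. a \<in> fst ` e}"
    then obtain z where e: "e = {(a, z)}" and f: "forbidden a z"
      by (auto simp: ev1_def)
    have "z \<in> ?X \<union> ?Y"
      using f unfolding forbidden_def
    proof (elim disjE bexE conjE)
      fix u v assume "u \<in> S" "v \<in> S" "(u, v, a) \<in> ordered_cherries E" "z \<in> mono_ends n c (g u) (g v)"
      then have "(u, v, a) \<in> ?A" "z \<in> mono_ends n c (g (fst (u, v, a))) (g (fst (snd (u, v, a))))"
        by (auto simp: ordered_cherries_at_def)
      then show ?thesis by blast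
    next
      fix u w assume uw: "u \<in> S" "w \<in> S" "(u, a, w) \<in> ordered_cherries E" "z \<in> mono_centres n c (g u) (g w)"
      then have "g u \<noteq> g w"
        using g ordered_cherriesD[OF G uw(3)] by (auto simp: bij_betw_def inj_on_def)
      then have "(g u, g w) \<in> ?B"
        using uw gP by auto
      then show ?thesis using uw by force
    qed
    then show "e \<in> (\<lambda>z. {(a, z)}) ` (?X \<union> ?Y)"
      using e by blast
  qed
  moreover have fin: "finite ?A" "finite ?B"
    using finite_T_at finite_P by auto
  ultimately have "card {e \<in> ev1. a \<in> fst ` e} \<le> card (?X \<union> ?Y)"
    by (intro surj_card_le) auto
  also have "\<dots> \<le> card ?X + card ?Y"
    by (rule card_Un_le)
  finally have "real (card {e \<in> ev1. a \<in> fst ` e}) \<le> real (card ?X) + real (card ?Y)"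
    by simp
  moreover have "real (card ?X) \<le> 6 * s ^ 3 * k"
  proof (rule card_UN_le_mult[OF fin(1) k0])
    have "card ?A \<le> card (ordered_cherries_at E a)"
      by (rule card_mono) (use finite_T_at in auto)
    then show "real (card ?A) \<le> 6 * s ^ 3"
      using light[of a] a by (simp add: L_def)
  qed (use ends_le g_less in auto)
  \<comment> \<open>The centres are counted over pairs of heavy images and not over the cherries at
    \<open>a\<close>: at most \<open>s ^ 2\<close> pairs with \<open>2 * s * k\<close> centres each.
    Counting over \<open>6 * s ^ 3\<close> cherries would cost a further factor of order
    \<open>s\<close>.\<close>
  moreover have "real (card ?Y) \<le> (s * s) * (2 * s * k)"
  proof (rule card_UN_le_mult[OF fin(2)])
    have "card ?B \<le> card (P \<times> P)"
      by (rule card_mono) (use finite_P in auto)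
    then have "real (card ?B) \<le> real (card P) * real (card P)"
      by (simp add: card_cartesian_product flip: of_nat_mult)
    also have "\<dots> \<le> s * s"
      using card_P s1 by (intro mult_mono) auto
    finally show "real (card ?B) \<le> s * s" .
  qed (use P s1 k1 in \<open>auto simp: spread_def\<close>)
  moreover have "(s * s) * (2 * s * k) = 2 * (s ^ 3 * k)"
    by (simp add: power3_eq_cube)
  ultimately show ?thesis
    by simp
qed

text \<open>For a fixed cherry, one light image ranges over \<open>n\<close> values and local
  boundedness leaves \<open>k\<close> for the other. Against a weight of order
  \<open>1 / n ^ 2\<close> this is a contribution of order \<open>k / n\<close> per cherry.\<close>

lemma card_ev_lhl_at:
  assumes a: "a \<in> L"
  shows "real (card {e \<in> ev_lhl. a \<in> fst ` e}) \<le> 6 * s ^ 3 * (real n * k)"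
proof (rule card_image_Sigma_le)
  let ?A = "{t \<in> ordered_cherries_at E a. fst (snd t) \<in> S}"
  let ?B = "\<lambda>t. SIGMA x:{..<n}. mono_ends n c x (g (fst (snd t)))"
  let ?\<phi> = "\<lambda>((u, v, w), x, z). {(u, x), (w, z)}"
  show "{e \<in> ev_lhl. a \<in> fst ` e} \<subseteq> ?\<phi> ` Sigma ?A ?B"
  proof
    fix e assume e: "e \<in> {e \<in> ev_lhl. a \<in> fst ` e}"
    then obtain u v w x z where *: "e = {(u, x), (w, z)}" "(u, v, w) \<in> ordered_cherries E" "v \<in> S"
      "x \<in> Q" "z \<in> mono_ends n c x (g v)"
      unfolding ev_lhl_def by blast
    then have "a \<in> {u, v, w}"
      using e by auto
    then show "e \<in> ?\<phi> ` Sigma ?A ?B"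
      using * by (intro image_eqI[of _ _ "((u, v, w), x, z)"]) (auto simp: ordered_cherries_at_def Q_def)
  qed
  have "card ?A \<le> card (ordered_cherries_at E a)"
    by (rule card_mono) (use finite_T_at in auto)
  then show "real (card ?A) \<le> 6 * s ^ 3"
    using light[of a] a by (simp add: L_def)
  show "real (card (?B t)) \<le> real n * k" if "t \<in> ?A" for t
    using card_Sigma_le[of "{..<n}" "\<lambda>x. mono_ends n c x (g (fst (snd t)))" k] ends_le g_less that
    by auto
qed (use finite_T_at k0 in auto)

lemma card_ev_hll_at:
  assumes a: "a \<in> L"
  shows "real (card {e \<in> ev_hll. a \<in> fst ` e}) \<le> 6 * s ^ 3 * (real n * k)"
proof (rule card_image_Sigma_le)
  let ?A = "ordered_cherries_at E a"
  let ?B = "\<lambda>t. SIGMA y:{..<n}. mono_ends n c (g (fst t)) y"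
  let ?\<phi> = "\<lambda>((u, v, w), y, z). {(v, y), (w, z)}"
  show "{e \<in> ev_hll. a \<in> fst ` e} \<subseteq> ?\<phi> ` Sigma ?A ?B"
  proof
    fix e assume e: "e \<in> {e \<in> ev_hll. a \<in> fst ` e}"
    then obtain u v w y z where *: "e = {(v, y), (w, z)}" "(u, v, w) \<in> ordered_cherries E"
      "y \<in> Q" "z \<in> mono_ends n c (g u) y"
      unfolding ev_hll_def by blast
    then have "a \<in> {u, v, w}"
      using e by auto
    then show "e \<in> ?\<phi> ` Sigma ?A ?B"
      using * by (intro image_eqI[of _ _ "((u, v, w), y, z)"]) (auto simp: ordered_cherries_at_def Q_def)
  qed
  show "real (card ?A) \<le> 6 * s ^ 3"
    using light[of a] a by (simp add: L_def)
  show "real (card (?B t)) \<le> real n * k" for t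
    using card_Sigma_le[of "{..<n}" "\<lambda>y. mono_ends n c (g (fst t)) y" k] ends_le by auto
qed (use finite_T_at k0 in auto)

lemma card_ev_lll_at:
  assumes a: "a \<in> L"
  shows "real (card {e \<in> ev_lll. a \<in> fst ` e}) \<le> 6 * s ^ 3 * (real n * (real n * k))"
proof (rule card_image_Sigma_le)
  let ?A = "ordered_cherries_at E a"
  let ?B = "SIGMA x:{..<n}. SIGMA y:{..<n}. mono_ends n c x y"
  let ?\<phi> = "\<lambda>((u, v, w), x, y, z). {(u, x), (v, y), (w, z)}"
  show "{e \<in> ev_lll. a \<in> fst ` e} \<subseteq> ?\<phi> ` Sigma ?A (\<lambda>_. ?B)"
  proof
    fix e assume e: "e \<in> {e \<in> ev_lll. a \<in> fst ` e}"
    then obtain u v w x y z where *: "e = {(u, x), (v, y), (w, z)}" "(u, v, w) \<in> ordered_cherries E"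
      "x \<in> Q" "y \<in> Q" "z \<in> mono_ends n c x y"
      unfolding ev_lll_def by blast
    then have "a \<in> {u, v, w}"
      using e by auto
    then show "e \<in> ?\<phi> ` Sigma ?A (\<lambda>_. ?B)"
      using * by (intro image_eqI[of _ _ "((u, v, w), x, y, z)"]) (auto simp: ordered_cherries_at_def Q_def)
  qed
  show "real (card ?A) \<le> 6 * s ^ 3"
    using light[of a] a by (simp add: L_def)
  have "real (card (SIGMA y:{..<n}. mono_ends n c x y)) \<le> real n * k" for x
    using card_Sigma_le[of "{..<n}" "\<lambda>y. mono_ends n c x y" k] ends_le by auto
  then show "real (card ?B) \<le> real n * (real n * k)"
    using card_Sigma_le[of "{..<n}" "\<lambda>x. SIGMA y:{..<n}. mono_ends n c x y" "real n * k"] by auto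
qed (use finite_T_at k0 in auto)

section \<open>Counting the events on a given image\<close>

text \<open>An event here is determined by \<open>a\<close> once \<open>b\<close> is fixed, and in
  both clauses of \<open>forbidden\<close> the vertex \<open>a\<close> is adjacent to
  \<open>S\<close>. The bound is \<open>card S\<close> times the maximum degree.\<close>

lemma card_ev1_on: "real (card {e \<in> ev1. b \<in> snd ` e}) \<le> 2 * s ^ 3"
proof -
  let ?X = "\<Union>u\<in>S. neighbours E u"
  have "{e \<in> ev1. b \<in> snd ` e} \<subseteq> (\<lambda>a. {(a, b)}) ` ?X"
  proof
    fix e assume "e \<in> {e \<in> ev1. b \<in> snd ` e}"
    then obtain a where e: "e = {(a, b)}" and f: "forbidden a b"
      by (auto simp: ev1_def)
    then have "a \<in> ?X"
      unfolding forbidden_def ordered_cherries_def neighbours_def by (auto simp: insert_commute)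
    then show "e \<in> (\<lambda>a. {(a, b)}) ` ?X"
      using e by blast
  qed
  then have "card {e \<in> ev1. b \<in> snd ` e} \<le> card ?X"
    by (intro surj_card_le) (use finite_S finite_neighbours[OF G] in auto)
  moreover have "real (card ?X) \<le> s * (2 * s ^ 2)"
    by (rule card_UN_le_mult[OF finite_S _ degree_le[OF G s1 T] S(2)]) (use S in auto)
  ultimately show ?thesis
    by (simp add: power2_eq_square power3_eq_cube)
qed

text \<open>The value \<open>b\<close> may belong to either light leaf, and
  \<open>mono_ends_commute\<close> makes the two roles symmetric. In each, an ordered cherry leaves
  \<open>k\<close> images for the other leaf.\<close>

lemma card_ev_lhl_on:
  assumes b: "b \<in> Q"
  shows "real (card {e \<in> ev_lhl. b \<in> snd ` e}) \<le> 4 * (s ^ 4 * k)"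
proof -
  let ?A = "{t \<in> ordered_cherries E. fst (snd t) \<in> S}"
  let ?B = "\<lambda>t. mono_ends n c b (g (fst (snd t)))"
  let ?\<phi> = "\<lambda>((u, v, w), z). {(u, b), (w, z)}" and ?\<psi> = "\<lambda>((u, v, w), x). {(u, x), (w, b)}"
  have "e \<in> ?\<phi> ` Sigma ?A ?B \<union> ?\<psi> ` Sigma ?A ?B" if e: "e \<in> ev_lhl" "b \<in> snd ` e" for e
  proof -
    obtain u v w x z where *: "e = {(u, x), (w, z)}" "(u, v, w) \<in> ordered_cherries E" "v \<in> S"
      "x \<in> Q" "z \<in> Q" "z \<in> mono_ends n c x (g v)"
      using e(1) unfolding ev_lhl_def by blast
    have "x \<in> mono_ends n c z (g v)"
      by (rule mono_ends_commute) (use * gP in \<open>auto simp: Q_def\<close>)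
    moreover consider "x = b" | "z = b"
      using e(2) *(1) by auto
    ultimately have "((u, v, w), z) \<in> Sigma ?A ?B \<and> e = {(u, b), (w, z)} \<or>
        ((u, v, w), x) \<in> Sigma ?A ?B \<and> e = {(u, x), (w, b)}"
      using * by cases auto
    then show ?thesis
    proof
      assume "((u, v, w), z) \<in> Sigma ?A ?B \<and> e = {(u, b), (w, z)}"
      then show ?thesis
        by (intro UnI1 image_eqI[of _ _ "((u, v, w), z)"]) auto
    next
      assume "((u, v, w), x) \<in> Sigma ?A ?B \<and> e = {(u, x), (w, b)}"
      then show ?thesis
        by (intro UnI2 image_eqI[of _ _ "((u, v, w), x)"]) auto
    qed
  qed
  then have sub: "{e \<in> ev_lhl. b \<in> snd ` e} \<subseteq> ?\<phi> ` Sigma ?A ?B \<union> ?\<psi> ` Sigma ?A ?B"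
    by blast
  have A: "finite ?A" "real (card ?A) \<le> 2 * s ^ 4"
    using finite_T card_mono[OF finite_T, of ?A] T by auto
  have fin: "finite (?\<phi> ` Sigma ?A ?B)" "finite (?\<psi> ` Sigma ?A ?B)"
    using A by auto
  have "card {e \<in> ev_lhl. b \<in> snd ` e} \<le> card (?\<phi> ` Sigma ?A ?B) + card (?\<psi> ` Sigma ?A ?B)"
    using card_mono[OF _ sub] card_Un_le[of "?\<phi> ` Sigma ?A ?B" "?\<psi> ` Sigma ?A ?B"] fin
    by (meson finite_UnI order_trans)
  moreover have "real (card (?\<phi> ` Sigma ?A ?B)) \<le> 2 * s ^ 4 * k"
    by (rule card_image_Sigma_le[OF subset_refl A(1) _ _ A(2) k0]) (use ends_le g_less in auto)
  moreover have "real (card (?\<psi> ` Sigma ?A ?B)) \<le> 2 * s ^ 4 * k"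
    by (rule card_image_Sigma_le[OF subset_refl A(1) _ _ A(2) k0]) (use ends_le g_less in auto)
  ultimately show ?thesis
    by linarith
qed

text \<open>If \<open>b\<close> is the image of the centre, local boundedness leaves
  \<open>k\<close> ends per ordered cherry. If \<open>b\<close> is the image of the light leaf,
  local boundedness does not limit the centres, and the cherries are grouped by their heavy
  leaf.\<close>

lemma card_ev_hll_on:
  assumes b: "b \<in> Q"
  shows "real (card {e \<in> ev_hll. b \<in> snd ` e}) \<le> 2 * (s ^ 4 * k) + 2 * s ^ 3 * (real n + 2 * (s ^ 3 * k))"
proof -
  let ?A = "ordered_cherries E"
  let ?B = "\<lambda>t. mono_ends n c (g (fst t)) b"
  let ?C = "SIGMA u:S. {(v, w). (u, v, w) \<in> ordered_cherries E} \<times> mono_centres n c (g u) b"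
  let ?\<phi> = "\<lambda>((u, v, w), z). {(v, b), (w, z)}" and ?\<psi> = "\<lambda>(u, (v, w), y). {(v, y), (w, b)}"
  have "e \<in> ?\<phi> ` Sigma ?A ?B \<union> ?\<psi> ` ?C" if e: "e \<in> ev_hll" "b \<in> snd ` e" for e
  proof -
    obtain u v w y z where *: "e = {(v, y), (w, z)}" "(u, v, w) \<in> ordered_cherries E" "u \<in> S"
      "y \<in> Q" "z \<in> Q" "z \<in> mono_ends n c (g u) y"
      using e(1) unfolding ev_hll_def by blast
    have "y \<in> mono_centres n c (g u) z"
      using * gP[OF *(3)] by (auto simp: mono_ends_def mono_centres_def Q_def)
    moreover consider "y = b" | "z = b"
      using e(2) *(1) by auto
    ultimately have "((u, v, w), z) \<in> Sigma ?A ?B \<and> e = {(v, b), (w, z)} \<or>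
        (u, (v, w), y) \<in> ?C \<and> e = {(v, y), (w, b)}"
      using * by cases auto
    then show ?thesis
    proof
      assume "((u, v, w), z) \<in> Sigma ?A ?B \<and> e = {(v, b), (w, z)}"
      then show ?thesis
        by (intro UnI1 image_eqI[of _ _ "((u, v, w), z)"]) auto
    next
      assume "(u, (v, w), y) \<in> ?C \<and> e = {(v, y), (w, b)}"
      then show ?thesis
        by (intro UnI2 image_eqI[of _ _ "(u, (v, w), y)"]) auto
    qed
  qed
  then have sub: "{e \<in> ev_hll. b \<in> snd ` e} \<subseteq> ?\<phi> ` Sigma ?A ?B \<union> ?\<psi> ` ?C"
    by blast
  have finl: "finite {(v, w). (u, v, w) \<in> ordered_cherries E}" for u
    by (rule finite_subset[of _ "snd ` ordered_cherries E"]) (use finite_T in force)+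
  then have finC: "finite ?C"
    using finite_S by (intro finite_SigmaI finite_cartesian_product) auto
  have fin: "finite (?\<phi> ` Sigma ?A ?B)" "finite (?\<psi> ` ?C)"
    using finite_T finC by auto
  have "card {e \<in> ev_hll. b \<in> snd ` e} \<le> card (?\<phi> ` Sigma ?A ?B) + card (?\<psi> ` ?C)"
    using card_mono[OF _ sub] card_Un_le[of "?\<phi> ` Sigma ?A ?B" "?\<psi> ` ?C"] fin
    by (meson finite_UnI order_trans)
  moreover have "real (card (?\<phi> ` Sigma ?A ?B)) \<le> 2 * s ^ 4 * k"
    by (rule card_image_Sigma_le[OF subset_refl finite_T _ _ T k0]) (use ends_le b in \<open>auto simp: Q_def\<close>)
  moreover have "card (?\<psi> ` ?C) \<le> card ?C"
    by (rule card_image_le[OF finC])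
  moreover have "real (card ?C) \<le> 2 * s ^ 3 * (real n + 2 * (s ^ 3 * k))"
  proof -
    have "real (card ?C) = (\<Sum>u\<in>S. real (card {(v, w). (u, v, w) \<in> ordered_cherries E}) *
        real (card (mono_centres n c (g u) b)))"
      using finite_S finl by (simp add: card_cartesian_product)
    \<comment> \<open>The cherry count is bounded uniformly in \<open>u\<close> so that the centres
      can be summed over all of \<open>P\<close>. The result has order \<open>s ^ 3 * n\<close>; up
      to \<open>n\<close> centres for every ordered cherry would give \<open>s ^ 4 * n\<close>, too
      much when \<open>k\<close> is small.\<close>
    also have "\<dots> \<le> (\<Sum>u\<in>S. 2 * s ^ 3 * real (card (mono_centres n c (g u) b)))"
      using S(1) by (intro sum_mono mult_right_mono card_leaf_cherries_le[OF G s1 T]) auto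
    also have "\<dots> = 2 * s ^ 3 * (\<Sum>u\<in>S. real (card (mono_centres n c (g u) b)))"
      by (simp add: sum_distrib_left)
    also have "\<dots> \<le> 2 * s ^ 3 * (real n + 2 * (s ^ 3 * k))"
    proof (rule mult_left_mono)
      have "(\<Sum>u\<in>S. real (card (mono_centres n c (g u) b))) =
          (\<Sum>x\<in>P. real (card (mono_centres n c x b)))"
        by (rule sum.reindex_bij_betw[OF g])
      also have "\<dots> \<le> real n + real (card P) ^ 2 * (2 * s * k)"
        by (rule spread_sum_mono_centres_le[OF P]) (use s1 k1 in simp)
      also have "\<dots> \<le> real n + s ^ 2 * (2 * s * k)"
        using s1 k1 card_P by (intro add_left_mono mult_right_mono power_mono) auto
      also have "s ^ 2 * (2 * s * k) = 2 * (s ^ 3 * k)"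
        by (simp add: power2_eq_square power3_eq_cube)
      finally show "(\<Sum>u\<in>S. real (card (mono_centres n c (g u) b))) \<le> real n + 2 * (s ^ 3 * k)" .
    qed (use s1 in simp)
    finally show ?thesis .
  qed
  ultimately show ?thesis
    by linarith
qed

text \<open>There is one family per position of \<open>b\<close>. In each, one further image is free
  and local boundedness leaves \<open>k\<close> values for the last.\<close>

lemma card_ev_lll_on:
  assumes b: "b \<in> Q"
  shows "real (card {e \<in> ev_lll. b \<in> snd ` e}) \<le> 6 * (s ^ 4 * k) * real n"
proof -
  let ?T = "ordered_cherries E"
  let ?B = "SIGMA y:{..<n}. mono_ends n c b y"
  let ?C = "SIGMA x:{..<n}. mono_ends n c x b"
  let ?\<phi>1 = "\<lambda>((u, v, w), y, z). {(u, b), (v, y), (w, z)}"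
  let ?\<phi>2 = "\<lambda>((u, v, w), x, z). {(u, x), (v, b), (w, z)}"
  let ?\<phi>3 = "\<lambda>((u, v, w), y, x). {(u, x), (v, y), (w, b)}"
  let ?X = "?\<phi>1 ` (?T \<times> ?B)" and ?Y = "?\<phi>2 ` (?T \<times> ?C)" and ?Z = "?\<phi>3 ` (?T \<times> ?B)"
  have "e \<in> ?X \<union> ?Y \<union> ?Z" if e: "e \<in> ev_lll" "b \<in> snd ` e" for e
  proof -
    obtain u v w x y z where *: "e = {(u, x), (v, y), (w, z)}" "(u, v, w) \<in> ?T"
      "x \<in> Q" "y \<in> Q" "z \<in> Q" "x \<noteq> y" "z \<in> mono_ends n c x y"
      using e(1) unfolding ev_lll_def by blast
    have comm: "x \<in> mono_ends n c z y"
      by (rule mono_ends_commute) (use * in \<open>auto simp: Q_def\<close>)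
    have less: "x < n" "y < n" "z < n"
      using * by (auto simp: Q_def)
    consider "x = b" | "y = b" | "z = b"
      using e(2) *(1) by auto
    then show ?thesis
    proof cases
      case 1
      then have "e \<in> ?X"
        using * less by (intro image_eqI[of _ _ "((u, v, w), y, z)"]) auto
      then show ?thesis by blast
    next
      case 2
      then have "e \<in> ?Y"
        using * less by (intro image_eqI[of _ _ "((u, v, w), x, z)"]) auto
      then show ?thesis by blast
    next
      case 3
      then have "e \<in> ?Z"
        using * less comm by (intro image_eqI[of _ _ "((u, v, w), y, x)"]) auto
      then show ?thesis by blast
    qed
  qed
  then have sub: "{e \<in> ev_lll. b \<in> snd ` e} \<subseteq> ?X \<union> ?Y \<union> ?Z"
    by blast
  have "finite (?X \<union> ?Y \<union> ?Z)"
    using finite_T by auto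
  then have "card {e \<in> ev_lll. b \<in> snd ` e} \<le> card (?X \<union> ?Y \<union> ?Z)"
    using sub by (rule card_mono)
  then have "card {e \<in> ev_lll. b \<in> snd ` e} \<le> card ?X + card ?Y + card ?Z"
    using card_Un_le[of "?X \<union> ?Y" ?Z] card_Un_le[of ?X ?Y] by linarith
  moreover have BC: "real (card ?B) \<le> real n * k" "real (card ?C) \<le> real n * k"
    using card_Sigma_le[of "{..<n}" "\<lambda>y. mono_ends n c b y" k]
      card_Sigma_le[of "{..<n}" "\<lambda>x. mono_ends n c x b" k] ends_le b by (auto simp: Q_def)
  moreover have "real (card ?X) \<le> 2 * s ^ 4 * (real n * k)"
    by (rule card_image_Sigma_le[OF subset_refl finite_T _ _ T]) (use BC k0 in auto)
  moreover have "real (card ?Y) \<le> 2 * s ^ 4 * (real n * k)"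
    by (rule card_image_Sigma_le[OF subset_refl finite_T _ _ T]) (use BC k0 in auto)
  moreover have "real (card ?Z) \<le> 2 * s ^ 4 * (real n * k)"
    by (rule card_image_Sigma_le[OF subset_refl finite_T _ _ T]) (use BC k0 in auto)
  ultimately show ?thesis
    by (simp add: mult_ac)
qed

section \<open>Shape and weights of the events\<close>

lemma
  assumes "e \<in> ev1"
  shows ev1_sub: "e \<subseteq> L \<times> Q" and ev1_inj: "partial_injection e" and ev1_card: "card e = 1"
  using assms by (auto simp: ev1_def partial_injection_def)

lemma
  assumes "e \<in> ev_lhl"
  shows ev_lhl_sub: "e \<subseteq> L \<times> Q" and ev_lhl_inj: "partial_injection e" and ev_lhl_card: "card e = 2"
proof -
  obtain u v w x z where e: "e = {(u, x), (w, z)}" "(u, v, w) \<in> ordered_cherries E"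
    "u \<in> L" "w \<in> L" "x \<in> Q" "z \<in> Q" "z \<in> mono_ends n c x (g v)"
    using assms unfolding ev_lhl_def by blast
  have d: "u \<noteq> w" "z \<noteq> x"
    using e ordered_cherriesD[OF G e(2)] by (auto simp: mono_ends_def)
  show "e \<subseteq> L \<times> Q" "partial_injection e" "card e = 2"
    using e d by (auto simp: partial_injection_def)
qed

lemma
  assumes "e \<in> ev_hll"
  shows ev_hll_sub: "e \<subseteq> L \<times> Q" and ev_hll_inj: "partial_injection e" and ev_hll_card: "card e = 2"
proof -
  obtain u v w y z where e: "e = {(v, y), (w, z)}" "(u, v, w) \<in> ordered_cherries E"
    "v \<in> L" "w \<in> L" "y \<in> Q" "z \<in> Q" "z \<in> mono_ends n c (g u) y"
    using assms unfolding ev_hll_def by blast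
  have d: "v \<noteq> w" "z \<noteq> y"
    using e ordered_cherriesD[OF G e(2)] by (auto simp: mono_ends_def)
  show "e \<subseteq> L \<times> Q" "partial_injection e" "card e = 2"
    using e d by (auto simp: partial_injection_def)
qed

lemma
  assumes "e \<in> ev_lll"
  shows ev_lll_sub: "e \<subseteq> L \<times> Q" and ev_lll_inj: "partial_injection e" and ev_lll_card: "card e = 3"
proof -
  obtain u v w x y z where e: "e = {(u, x), (v, y), (w, z)}" "(u, v, w) \<in> ordered_cherries E"
    "u \<in> L" "v \<in> L" "w \<in> L" "x \<in> Q" "y \<in> Q" "z \<in> Q" "x \<noteq> y" "z \<in> mono_ends n c x y"
    using assms unfolding ev_lll_def by blast
  have d: "u \<noteq> v" "v \<noteq> w" "u \<noteq> w" "z \<noteq> x" "z \<noteq> y"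
    using e ordered_cherriesD[OF G e(2)] by (auto simp: mono_ends_def)
  show "e \<subseteq> L \<times> Q" "partial_injection e" "card e = 3"
    using e d by (auto simp: partial_injection_def)
qed

lemma events_sub: "events \<subseteq> Pow (L \<times> Q)"
  using ev1_sub ev_lhl_sub ev_hll_sub ev_lll_sub unfolding events_def by blast

lemma finite_events: "finite events"
  by (rule finite_subset[OF events_sub]) (use finite_V in \<open>simp add: L_def Q_def\<close>)

lemma sum_weights_le:
  fixes t :: real
  assumes t: "0 \<le> t"
    and 1: "real (card {e \<in> ev1. R e}) \<le> C1" and 2: "real (card {e \<in> ev_lhl. R e}) \<le> C2"
    and 3: "real (card {e \<in> ev_hll. R e}) \<le> C3" and 4: "real (card {e \<in> ev_lll. R e}) \<le> C4"
  shows "(\<Sum>e | e \<in> events \<and> R e. t ^ card e) \<le> C1 * t + (C2 + C3) * t ^ 2 + C4 * t ^ 3"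
proof -
  let ?X = "{e \<in> ev1. R e}" and ?Y = "{e \<in> ev_lhl. R e}" and ?Z = "{e \<in> ev_hll. R e}"
    and ?W = "{e \<in> ev_lll. R e}"
  let ?w = "\<lambda>e :: ('a \<times> nat) set. t ^ card e"
  have fin: "finite ?X" "finite ?Y" "finite ?Z" "finite ?W"
    using finite_events by (auto simp: events_def)
  have un: "sum ?w (A \<union> B) \<le> sum ?w A + sum ?w B" if "finite A" "finite B" for A B
    using sum.union_inter[OF that, of ?w] sum_nonneg[of "A \<inter> B" ?w] t by simp
  have "{e \<in> events. R e} = ?X \<union> ?Y \<union> ?Z \<union> ?W"
    by (auto simp: events_def)
  then have "sum ?w {e \<in> events. R e} \<le> sum ?w ?X + sum ?w ?Y + sum ?w ?Z + sum ?w ?W"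
    using un[of "?X \<union> ?Y \<union> ?Z" ?W] un[of "?X \<union> ?Y" ?Z] un[of ?X ?Y] fin by simp
  moreover have "sum ?w ?X = real (card ?X) * t" "sum ?w ?Y = real (card ?Y) * t ^ 2"
    "sum ?w ?Z = real (card ?Z) * t ^ 2" "sum ?w ?W = real (card ?W) * t ^ 3"
    using ev1_card ev_lhl_card ev_hll_card ev_lll_card by simp_all
  moreover have "real (card ?X) * t \<le> C1 * t" "real (card ?Y) * t ^ 2 \<le> C2 * t ^ 2"
    "real (card ?Z) * t ^ 2 \<le> C3 * t ^ 2" "real (card ?W) * t ^ 3 \<le> C4 * t ^ 3"
    using assms by (auto intro: mult_right_mono)
  ultimately show ?thesis
    by (simp add: distrib_right)
qed

section \<open>Numerical check of the local lemma and gluing of the two embeddings\<close>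

lemma ex_extension:
  obtains f where "bij_betw f L Q" "\<And>e. e \<in> events \<Longrightarrow> \<not> extends e f"
proof -
  \<comment> \<open>\<open>B\<close> bounds \<open>s ^ 3 * k\<close>; measured in units of
    \<open>B\<close>, all estimates below become pure numbers.\<close>
  define B where "B = real n / 560"
  define q where "q = s ^ 3 * k"
  have s3: "1 \<le> s ^ 3"
    using s1 by simp
  have q1: "s ^ 3 \<le> q"
    unfolding q_def using mult_left_mono[OF k1, of "s ^ 3"] s1 by simp
  have ss: "s \<le> s ^ 3"
    using power_increasing[of 1 3 s] s1 by simp
  have qB: "q \<le> B"
    using nbig by (simp add: q_def B_def)
  have B1: "1 \<le> B"
    using s3 q1 qB by linarith
  have n: "real n = 560 * B"
    by (simp add: B_def)
  \<comment> \<open>Since \<open>card Q \<ge> 560 * B - s \<ge> 559 * B\<close> and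
    \<open>B \<ge> 1\<close>, the choice \<open>554 * B\<close> leaves ample room for
    \<open>N + 2 \<le> card Q\<close>.\<close>
  define N where "N = 554 * B"
  have N0: "0 < N"
    using B1 by (simp add: N_def)
  \<comment> \<open>A bound quadratic in \<open>B\<close> suffices, because these counts come with
    \<open>(1 / N) ^ 2\<close>, or with \<open>n * (1 / N) ^ 3\<close>.\<close>
  have s4: "s ^ 4 * k \<le> B * B"
  proof -
    have "s ^ 4 * k = s * q"
      by (simp add: q_def power3_eq_cube power4_eq_xxxx)
    also have "\<dots> \<le> B * B"
      using ss q1 qB s1 B1 by (intro mult_mono) linarith+
    finally show ?thesis .
  qed
  have cardQ: "real (card Q) = real n - real (card P)"
    using P_sub finite_P card_mono[OF _ P_sub] by (simp add: Q_def card_Diff_subset of_nat_diff)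
  have cardL: "card L = card Q"
    using S finite_S P_sub finite_P cardV bij_betw_same_card[OF g]
    by (simp add: L_def Q_def card_Diff_subset)
  have at: "(\<Sum>e | e \<in> events \<and> a \<in> fst ` e. (1 / N) ^ card e) \<le> 1 / 20" if a: "a \<in> L" for a
  proof -
    have "(\<Sum>e | e \<in> events \<and> a \<in> fst ` e. (1 / N) ^ card e) \<le>
        8 * B * (1 / N) + (6 * B * real n + 6 * B * real n) * (1 / N) ^ 2 + 6 * B * (real n * real n) * (1 / N) ^ 3"
    proof (rule sum_weights_le)
      have le1: "6 * s ^ 3 * (real n * k) = 6 * q * real n"
        and le2: "6 * s ^ 3 * (real n * (real n * k)) = 6 * q * (real n * real n)"
        by (simp_all add: q_def)
      have le3: "6 * q * real n \<le> 6 * B * real n" "6 * q * (real n * real n) \<le> 6 * B * (real n * real n)"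
        using qB by (auto intro!: mult_right_mono)
      show "real (card {e \<in> ev1. a \<in> fst ` e}) \<le> 8 * B"
        using card_ev1_at[OF a] qB by (simp add: q_def)
      show "real (card {e \<in> ev_lhl. a \<in> fst ` e}) \<le> 6 * B * real n"
        using card_ev_lhl_at[OF a] le1 le3 by linarith
      show "real (card {e \<in> ev_hll. a \<in> fst ` e}) \<le> 6 * B * real n"
        using card_ev_hll_at[OF a] le1 le3 by linarith
      show "real (card {e \<in> ev_lll. a \<in> fst ` e}) \<le> 6 * B * (real n * real n)"
        using card_ev_lll_at[OF a] le2 le3 by linarith
    qed (use N0 in simp)
    also have "\<dots> = 8 / 554 + 12 * 560 / 554 ^ 2 + 6 * 560 ^ 2 / 554 ^ 3"
      using B1 by (simp add: n N_def field_simps power2_eq_square power3_eq_cube)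
    also have "\<dots> \<le> 1 / 20"
      by simp
    finally show ?thesis .
  qed
  have on: "(\<Sum>e | e \<in> events \<and> b \<in> snd ` e. (1 / N) ^ card e) \<le> 1 / 50" if b: "b \<in> Q" for b
  proof -
    have "(\<Sum>e | e \<in> events \<and> b \<in> snd ` e. (1 / N) ^ card e) \<le>
        2 * B * (1 / N) + (4 * (B * B) + (2 * (B * B) + 2 * B * (real n + 2 * B))) * (1 / N) ^ 2
        + 6 * (B * B) * real n * (1 / N) ^ 3"
    proof (rule sum_weights_le)
      show "real (card {e \<in> ev1. b \<in> snd ` e}) \<le> 2 * B"
        using card_ev1_on[of b] q1 qB by linarith
      show "real (card {e \<in> ev_lhl. b \<in> snd ` e}) \<le> 4 * (B * B)"
        using card_ev_lhl_on[OF b] s4 by linarith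
      have "2 * s ^ 3 * (real n + 2 * (s ^ 3 * k)) \<le> 2 * B * (real n + 2 * B)"
        unfolding q_def[symmetric] using q1 qB s3 of_nat_0_le_iff[of n] by (intro mult_mono) linarith+
      then show "real (card {e \<in> ev_hll. b \<in> snd ` e}) \<le> 2 * (B * B) + 2 * B * (real n + 2 * B)"
        using card_ev_hll_on[OF b] s4 by linarith
      have "6 * (s ^ 4 * k) * real n \<le> 6 * (B * B) * real n"
        using s4 by (intro mult_right_mono) auto
      then show "real (card {e \<in> ev_lll. b \<in> snd ` e}) \<le> 6 * (B * B) * real n"
        using card_ev_lll_on[OF b] by linarith
    qed (use N0 in simp)
    also have "\<dots> = 2 / 554 + 1130 / 554 ^ 2 + 6 * 560 / 554 ^ 3"
      using B1 by (simp add: n N_def field_simps power2_eq_square power3_eq_cube)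
    also have "\<dots> \<le> 1 / 50"
      by simp
    finally show ?thesis .
  qed
  show ?thesis
  \<comment> \<open>The two bounds give \<open>3 * (1 / 20 + 1 / 50) = 21 / 100\<close>, below the
    permitted \<open>1 / 4\<close>.\<close>
  proof (rule ex_bijection_avoiding[of L Q events N "1 / 20" "1 / 50"])
    show "finite L" "finite Q"
      using finite_V by (auto simp: L_def Q_def)
    show "N + 2 \<le> real (card Q)"
      using cardQ card_P ss q1 qB B1 n by (simp add: N_def)
    fix e assume e: "e \<in> events"
    show "e \<subseteq> L \<times> Q"
      using e events_sub by blast
    show "partial_injection e"
      using e ev1_inj ev_lhl_inj ev_hll_inj ev_lll_inj unfolding events_def by blast
    have "card e \<in> {1, 2, 3}"
      using e ev1_card ev_lhl_card ev_hll_card ev_lll_card unfolding events_def by blast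
    then show "e \<noteq> {}" "card e \<le> 3"
      by auto
  qed (use cardL N0 at on that in auto)
qed

text \<open>A cherry with monochromatic image either lies in \<open>S\<close>, against
  \<open>spread\<close>, or realises one of the avoided events. The cases follow the heavy and light
  vertices.\<close>

lemma ex_proper_embedding:
  obtains h where "bij_betw h V {..<n}"
    "\<And>u v w. (u, v, w) \<in> ordered_cherries E \<Longrightarrow> c {h u, h v} \<noteq> c {h v, h w}"
proof -
  obtain f where f: "bij_betw f L Q" "\<And>e. e \<in> events \<Longrightarrow> \<not> extends e f"
    using ex_extension by blast
  define h where "h u = (if u \<in> S then g u else f u)" for u
  have hS: "h u = g u" if "u \<in> S" for u
    using that by (simp add: h_def)
  have hL: "h u = f u" "h u \<in> Q" if "u \<in> L" for u
    using that f(1) by (auto simp: h_def L_def bij_betw_def)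
  have "bij_betw h S P"
    using g by (rule bij_betw_cong[THEN iffD1, rotated]) (simp add: hS)
  moreover have "bij_betw h L Q"
    using f(1) by (rule bij_betw_cong[THEN iffD1, rotated]) (simp add: hL)
  ultimately have "bij_betw h (S \<union> L) (P \<union> Q)"
    by (rule bij_betw_combine) (auto simp: Q_def)
  moreover have "S \<union> L = V" "P \<union> Q = {..<n}"
    using S P_sub by (auto simp: L_def Q_def)
  ultimately have bij: "bij_betw h V {..<n}"
    by simp
  have "c {h u, h v} \<noteq> c {h v, h w}" if t: "(u, v, w) \<in> ordered_cherries E" for u v w
  proof
    assume eq: "c {h u, h v} = c {h v, h w}"
    note d = ordered_cherriesD[OF G t]
    have hd: "h u \<noteq> h v" "h v \<noteq> h w" "h u \<noteq> h w" "h u < n" "h v < n" "h w < n"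
      using bij d by (auto simp: bij_betw_def inj_on_def)
    have ends: "h w \<in> mono_ends n c (h u) (h v)" and ends': "h u \<in> mono_ends n c (h w) (h v)"
      and centre: "h v \<in> mono_centres n c (h u) (h w)"
      using eq hd by (auto simp: mono_ends_def mono_centres_def insert_commute)
    \<comment> \<open>The reversed cherry serves the cases in which \<open>u\<close> is light and
      \<open>w\<close> is heavy.\<close>
    have t': "(w, v, u) \<in> ordered_cherries E"
      using t by (auto simp: ordered_cherries_def insert_commute)
    have no: False if "e \<in> events" "extends e f" for e
      using f(2) that by blast
    have sl: "x \<in> S \<or> x \<in> L" if "x \<in> V" for x
      using that by (auto simp: L_def)
    consider "u \<in> S" "v \<in> S" "w \<in> S" | "u \<in> S" "v \<in> S" "w \<in> L" | "u \<in> L" "v \<in> S" "w \<in> S"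
      | "u \<in> S" "v \<in> L" "w \<in> S" | "u \<in> L" "v \<in> S" "w \<in> L" | "u \<in> S" "v \<in> L" "w \<in> L"
      | "u \<in> L" "v \<in> L" "w \<in> S" | "u \<in> L" "v \<in> L" "w \<in> L"
      using sl d by blast
    then show False
    proof cases
      case 1
      then show ?thesis
        using P ends hd hS gP unfolding spread_def by (metis disjoint_iff)
    next
      case 2
      then have "forbidden w (h w)"
        unfolding forbidden_def using t ends hS by metis
      then have "{(w, h w)} \<in> events"
        using 2 hL by (auto simp: events_def ev1_def)
      then show ?thesis
        using no 2 hL by (auto simp: extends_def)
    next
      case 3
      then have "forbidden u (h u)"
        unfolding forbidden_def using t' ends' hS by metis
      then have "{(u, h u)} \<in> events"
        using 3 hL by (auto simp: events_def ev1_def)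
      then show ?thesis
        using no 3 hL by (auto simp: extends_def)
    next
      case 4
      then have "forbidden v (h v)"
        unfolding forbidden_def using t centre hS by metis
      then have "{(v, h v)} \<in> events"
        using 4 hL by (auto simp: events_def ev1_def)
      then show ?thesis
        using no 4 hL by (auto simp: extends_def)
    next
      case 5
      then have "{(u, h u), (w, h w)} \<in> ev_lhl"
        unfolding ev_lhl_def using t ends[unfolded hS[OF 5(2)]] hL(2)[of u] hL(2)[of w] by blast
      then show ?thesis
        using no[of "{(u, h u), (w, h w)}"] 5 hL by (auto simp: extends_def events_def)
    next
      case 6
      then have "{(v, h v), (w, h w)} \<in> ev_hll"
        unfolding ev_hll_def using t ends[unfolded hS[OF 6(1)]] hL(2)[of v] hL(2)[of w] by blast
      then show ?thesis
        using no[of "{(v, h v), (w, h w)}"] 6 hL by (auto simp: extends_def events_def)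
    next
      case 7
      then have "{(v, h v), (u, h u)} \<in> ev_hll"
        unfolding ev_hll_def using t' ends'[unfolded hS[OF 7(3)]] hL(2)[of v] hL(2)[of u] by blast
      then show ?thesis
        using no[of "{(v, h v), (u, h u)}"] 7 hL by (auto simp: extends_def events_def)
    next
      case 8
      then have "{(u, h u), (v, h v), (w, h w)} \<in> ev_lll"
        unfolding ev_lll_def using t ends hd(1) hL(2)[of u] hL(2)[of v] hL(2)[of w] by blast
      then show ?thesis
        using no[of "{(u, h u), (v, h v), (w, h w)}"] 8 hL by (auto simp: extends_def events_def)
    qed
  qed
  then show ?thesis
    using that bij by blast
qed

end

section \<open>From properly coloured cherries to the theorem\<close>

text \<open>By injectivity of \<open>h\<close>, two distinct image edges that meet come from two
  edges of \<open>E\<close> with a common vertex, which form an ordered cherry.\<close>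

lemma graph_properI:
  assumes G: "simple_graph V E" and h: "bij_betw h V {..<n}"
    and ne: "\<And>u v w. (u, v, w) \<in> ordered_cherries E \<Longrightarrow> c {h u, h v} \<noteq> c {h v, h w}"
  shows "graph_proper n V E c"
proof -
  let ?F = "(\<lambda>e. h ` e) ` E"
  have edge: "\<exists>u v. e = {u, v} \<and> u \<noteq> v \<and> u \<in> V \<and> v \<in> V" if "e \<in> E" for e
  proof -
    have "e \<subseteq> V" "card e = 2"
      using G that by (auto simp: simple_graph_def nsets_def)
    then show ?thesis
      by (auto simp: card_2_iff)
  qed
  have "?F \<subseteq> complete_edges n"
  proof (rule image_subsetI)
    fix e assume e: "e \<in> E"
    then have "e \<subseteq> V" "finite e" "card e = 2"
      using G by (auto simp: simple_graph_def nsets_def)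
    moreover have "card (h ` e) = card e"
      using h \<open>e \<subseteq> V\<close> by (meson bij_betw_def card_image inj_on_subset)
    ultimately show "h ` e \<in> complete_edges n"
      using h by (auto simp: complete_edges_def nsets_def bij_betw_def)
  qed
  moreover have "proper_edge_coloring c ?F"
    unfolding proper_edge_coloring_def
  proof (intro ballI impI)
    fix d d' assume d: "d \<in> ?F" "d' \<in> ?F" "d \<noteq> d' \<and> d \<inter> d' \<noteq> {}"
    then obtain e e' where e: "e \<in> E" "e' \<in> E" "d = h ` e" "d' = h ` e'"
      by blast
    from d(3) e obtain a b where ab: "a \<in> e" "b \<in> e'" "h a = h b"
      by blast
    have "e \<subseteq> V" "e' \<subseteq> V"
      using edge e by blast+
    then have "a = b"
      using h ab by (auto simp: bij_betw_def inj_on_def)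
    obtain u where u: "e = {u, a}"
      using edge[OF e(1)] ab(1) by blast
    obtain w where w: "e' = {a, w}"
      using edge[OF e(2)] ab(2) \<open>a = b\<close> by blast
    have "u \<noteq> w"
      using d(3) e u w by (auto simp: insert_commute)
    then have "(u, a, w) \<in> ordered_cherries E"
      using e u w by (simp add: ordered_cherries_def)
    then show "c d \<noteq> c d'"
      using ne e u w by simp
  qed
  moreover have "graph_isomorphic V E {..<n} ?F"
    using h by (auto simp: graph_isomorphic_def)
  ultimately show ?thesis
    unfolding graph_proper_def by blast
qed

theorem theorem1p2:
  fixes n :: nat and r :: real
    and V :: "'a set" and E :: "'a set set"
    and c :: "nat set \<Rightarrow> 'c"
  assumes "n > 0" and "r > 0"
    and "simple_graph V E" and "card V = n"
    and "real (card (cherries V E)) \<le> r"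
    and "locally_bounded n (real n / (560 * r powr (3 / 4))) c"
  shows "graph_proper n V E c"
proof (cases "ordered_cherries E = {}")
  \<comment> \<open>Without cherries any bijection will do. Separating this case gives
    \<open>1 \<le> r\<close>, hence \<open>1 \<le> s\<close>, in the other one.\<close>
  case True
  have "finite V"
    using assms(3) by (simp add: simple_graph_def)
  then obtain h where "bij_betw h V {..<n}"
    using finite_same_card_bij[of V "{..<n}"] assms(4) by auto
  then show ?thesis
    by (rule graph_properI[OF assms(3)]) (simp add: True)
next
  case False
  define k where "k = real n / (560 * r powr (3 / 4))"
  define s where "s = r powr (1 / 4)"
  have lb: "locally_bounded n k c"
    using assms(6) by (simp add: k_def)
  have T0: "0 < card (ordered_cherries E)"
    using False finite_ordered_cherries[OF assms(3)] by (simp add: card_gt_0_iff)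
  then have "1 \<le> card (cherries V E)"
    using card_ordered_cherries_le[OF assms(3)] by linarith
  then have r1: "1 \<le> r"
    using assms(5) by linarith
  have s1: "1 \<le> s"
    using r1 by (simp add: s_def ge_one_powr_ge_zero)
  have s3: "s ^ 3 = r powr (3 / 4)" and s4: "s ^ 4 = r"
    using assms(2) by (simp_all add: s_def powr_powr flip: powr_realpow)
  have T: "real (card (ordered_cherries E)) \<le> 2 * s ^ 4"
    using card_ordered_cherries_le[OF assms(3)] assms(5) s4 by linarith
  have nbig: "560 * s ^ 3 * k \<le> real n"
    using assms(2) by (simp add: k_def s3)
  have "2 \<le> n"
  proof -
    obtain u v w where t: "(u, v, w) \<in> ordered_cherries E"
      using False by auto
    have "card {u, v} \<le> card V"
      by (rule card_mono) (use assms(3) ordered_cherriesD[OF assms(3) t] in \<open>auto simp: simple_graph_def\<close>)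
    then show ?thesis
      using assms(4) ordered_cherriesD[OF assms(3) t] by simp
  qed
  \<comment> \<open>The edge \<open>{0, 1}\<close> lies in its own colour class at the vertex 0, so
    the local bound itself forces \<open>1 \<le> k\<close>. Together with \<open>nbig\<close> this
    makes \<open>n\<close> large compared with \<open>s ^ 3\<close>.\<close>
  have k1: "1 \<le> k"
  proof -
    let ?F = "{e \<in> complete_edges n. 0 \<in> e \<and> c e = c {0, 1}}"
    have "finite ?F"
      by (rule finite_subset[of _ "Pow {..<n}"]) (auto simp: complete_edges_def nsets_def)
    moreover have "{0, 1} \<in> ?F"
      using \<open>2 \<le> n\<close> by (auto simp: complete_edges_def nsets_def)
    ultimately have "0 < card ?F"
      by (auto simp: card_gt_0_iff)
    moreover have "real (card ?F) \<le> k"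
      using lb assms(1) unfolding locally_bounded_def by blast
    ultimately show ?thesis
      by linarith
  qed
  define S where "S = {a \<in> V. real (card (ordered_cherries_at E a)) > 6 * s ^ 3}"
  have S: "S \<subseteq> V" "finite S" "real (card S) \<le> s"
    using card_heavy_le[OF assms(3) s1 T] assms(3) by (auto simp: S_def simple_graph_def)
  obtain P where P: "spread n c (2 * s * k) P" "card P = card S"
    using ex_spread_set[OF lb k1 s1 nbig S(3)] by blast
  have "finite P"
    using P(1) finite_subset[of P "{..<n}"] by (auto simp: spread_def)
  then obtain g where g: "bij_betw g S P"
    using finite_same_card_bij[OF S(2), of P] P(2) by auto
  interpret heavy_embedding n k s V E c S P g
    by unfold_locales (use assms lb k1 s1 nbig T S P g in \<open>auto simp: S_def\<close>)
  obtain h where "bij_betw h V {..<n}"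
    "\<And>u v w. (u, v, w) \<in> ordered_cherries E \<Longrightarrow> c {h u, h v} \<noteq> c {h v, h w}"
    using ex_proper_embedding by blast
  then show ?thesis
    by (rule graph_properI[OF assms(3)])
qed

end
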